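(* Let $p=0.05$, $q=0.4$, let $\mathcal N_1(\rho)=q\rho+(1-q)\sigma_z\rho\sigma_z$ be the qubit dephasing channel and $\mathcal N_2(\rho)=(1-p)\rho+p\,(\operatorname{Tr}\rho)\,I/2$ the qubit depolarizing channel, and let $f(\rho)=-D(\sqrt{\rho}\,\Gamma^{\mathcal N_1}\sqrt{\rho}\,\|\,\sqrt{\rho}\,\Gamma^{\mathcal N_2}\sqrt{\rho})=\operatorname{Tr}[\rho\,\Omega(\rho)]$. Let $H\in\{\sigma_x,\sigma_y,\sigma_z\}$, $E\in(-1,1)$, $\mathcal M=\{\rho:\rho\text{ a qubit density operator},\ \operatorname{Tr}\rho H=E\}$ and $N_{\mathcal M}=\operatorname{span}\{I,H\}$ (real span). Then $\Omega(\rho)-\nabla f(\rho)\in N_{\mathcal M}$ does not hold universally over the feasible set $\mathcal M$: there exists a positive-definite $\rho\in\mathcal M$ with $\Omega(\rho)-\nabla f(\rho)\notin N_{\mathcal M}$.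
   Context: $\mathcal H_A=\mathcal H_B=\mathbb C^2$; $\sigma_x,\sigma_y,\sigma_z$ are the Pauli matrices; $\log$ is the natural logarithm. For a channel $\mathcal N$ from $A$ to $B$, the (unnormalized) Choi matrix is $\Gamma^{\mathcal N}=\sum_{i,j}|i\rangle\langle j|_A\otimes\mathcal N(|i\rangle\langle j|)_B$. $D(\sigma\|\tau)=\operatorname{Tr}\,\sigma(\log\sigma-\log\tau)$. For a positive-definite state $\rho$ on $A$, powers of $\rho$ are understood as acting as $\rho^{s}\otimes I_B$, and $$\Omega_1(\rho)=-\operatorname{Tr}_B\!\big(\Gamma^{\mathcal N_1}\rho^{1/2}\big(\log(\rho^{1/2}\Gamma^{\mathcal N_1}\rho^{1/2})-\log(\rho^{1/2}\Gamma^{\mathcal N_2}\rho^{1/2})\big)\rho^{-1/2}\big),\qquad \Omega(\rho)=\tfrac12(\Omega_1(\rho)+\Omega_1(\rho)^\dagger),$$ where the logarithm of the singular operator $\rho^{1/2}\Gamma^{\mathcal N_1}\rho^{1/2}$ is taken on its support (and is $0$ on its kernel). $\nabla f(\rho)$ is the gradient with respect to the Hilbert–Schmidt inner product: a Hermitian matrix with $Df(\rho)[X]=\operatorname{Tr}[X\nabla f(\rho)]$ for all traceless Hermitian $X$ (determined up to adding multiples of $I$). *)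

theory Defs
  imports "HOL-Analysis.Analysis"
begin

section \<open>Matrices over the complex numbers\<close>

text \<open>
  Operators on a finite-dimensional Hilbert space with orthonormal basis indexed by \<open>'n\<close> are
  matrices \<open>complex^'n^'n\<close>; operators on a tensor product are matrices indexed by the product type.
  On the qubit type \<open>complex^2^2\<close>, index 1 is the first basis vector and index 2 the second.
\<close>

definition dagger :: "complex^'n^'m \<Rightarrow> complex^'m^'n" where
  "dagger A = (\<chi> i j. cnj (A $ j $ i))"

definition hermitian :: "complex^'n^'n \<Rightarrow> bool" where
  "hermitian A \<longleftrightarrow> dagger A = A"

definition unitary :: "complex^'n^'n \<Rightarrow> bool" where
  "unitary U \<longleftrightarrow> dagger U ** U = mat 1 \<and> U ** dagger U = mat 1"

definition quad_form :: "complex^'n^'n \<Rightarrow> complex^'n \<Rightarrow> complex" where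
  "quad_form A v = (\<Sum>i\<in>UNIV. cnj (v $ i) * (A *v v) $ i)"

definition positive_semidefinite :: "complex^'n^'n \<Rightarrow> bool" where
  "positive_semidefinite A \<longleftrightarrow> hermitian A \<and> (\<forall>v. 0 \<le> Re (quad_form A v))"

definition positive_definite :: "complex^'n^'n \<Rightarrow> bool" where
  "positive_definite A \<longleftrightarrow> hermitian A \<and> (\<forall>v. v \<noteq> 0 \<longrightarrow> 0 < Re (quad_form A v))"

definition density_operator :: "complex^'n^'n \<Rightarrow> bool" where
  "density_operator \<rho> \<longleftrightarrow> positive_semidefinite \<rho> \<and> trace \<rho> = 1"

definition real_diag :: "('n \<Rightarrow> real) \<Rightarrow> complex^'n^'n" where
  "real_diag d = (\<chi> i j. if i = j then complex_of_real (d i) else 0)"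

definition kron :: "complex^'a^'a \<Rightarrow> complex^'b^'b \<Rightarrow> complex^('a::finite \<times> 'b::finite)^('a::finite \<times> 'b::finite)" where
  "kron A B = (\<chi> r c. A $ fst r $ fst c * B $ snd r $ snd c)"

definition partial_trace_B :: "complex^('a::finite \<times> 'b::finite)^('a::finite \<times> 'b::finite) \<Rightarrow> complex^'a^'a" where
  "partial_trace_B M = (\<chi> i j. \<Sum>b\<in>UNIV. M $ (i, b) $ (j, b))"

definition ketbra :: "'n \<Rightarrow> 'n \<Rightarrow> complex^'n^'n" where
  "ketbra i j = (\<chi> k l. if k = i \<and> l = j then 1 else 0)"


section \<open>Functional calculus\<close>

text \<open>
  For Hermitian \<open>A\<close>, the matrix \<open>B\<close> below exists and does not depend on the chosen spectral
  decomposition of \<open>A\<close>.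
\<close>

definition matrix_fun :: "(real \<Rightarrow> real) \<Rightarrow> complex^'n^'n \<Rightarrow> complex^'n^'n" where
  "matrix_fun g A = (THE B. \<exists>U d. unitary U \<and>
     A = U ** real_diag d ** dagger U \<and> B = U ** real_diag (g \<circ> d) ** dagger U)"

definition matrix_power :: "complex^'n^'n \<Rightarrow> real \<Rightarrow> complex^'n^'n" where
  "matrix_power A s = matrix_fun (\<lambda>x. x powr s) A"

text \<open>For positive semidefinite matrices: the logarithm on the support, and 0 on the kernel.\<close>

definition matrix_log :: "complex^'n^'n \<Rightarrow> complex^'n^'n" where
  "matrix_log A = matrix_fun (\<lambda>x. if x > 0 then ln x else 0) A"

text \<open>
  The trace is real for Hermitian arguments. As a real-valued function this is the relative entropy
  whenever the support of \<open>\<sigma>\<close> is contained in that of \<open>\<tau>\<close> (otherwise the relative entropy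
  would be infinite).
\<close>

definition relative_entropy :: "complex^'n^'n \<Rightarrow> complex^'n^'n \<Rightarrow> real" where
  "relative_entropy \<sigma> \<tau> = Re (trace (\<sigma> ** (matrix_log \<sigma> - matrix_log \<tau>)))"


section \<open>Channels and Choi matrices\<close>

definition choi :: "(complex^'a^'a \<Rightarrow> complex^'b^'b) \<Rightarrow> complex^('a::finite \<times> 'b::finite)^('a::finite \<times> 'b::finite)" where
  "choi N = (\<Sum>i\<in>UNIV. \<Sum>j\<in>UNIV. kron (ketbra i j) (N (ketbra i j)))"

definition power_on_A :: "complex^'a^'a \<Rightarrow> real \<Rightarrow> complex^('a::finite \<times> 'b::finite)^('a::finite \<times> 'b::finite)" where
  "power_on_A \<rho> s = kron (matrix_power \<rho> s) (mat 1)"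

definition sandwiched_choi ::
  "(complex^'a^'a \<Rightarrow> complex^'b^'b) \<Rightarrow> complex^'a^'a \<Rightarrow> complex^('a::finite \<times> 'b::finite)^('a::finite \<times> 'b::finite)" where
  "sandwiched_choi N \<rho> = power_on_A \<rho> (1/2) ** choi N ** power_on_A \<rho> (1/2)"

definition Omega1 ::
  "(complex^'a^'a \<Rightarrow> complex^'b^'b) \<Rightarrow> (complex^'a^'a \<Rightarrow> complex^'b^'b) \<Rightarrow>
   complex^'a^'a \<Rightarrow> complex^'a^'a" where
  "Omega1 N1 N2 \<rho> = - partial_trace_B (choi N1 ** power_on_A \<rho> (1/2) **
     (matrix_log (sandwiched_choi N1 \<rho>) - matrix_log (sandwiched_choi N2 \<rho>)) **
     power_on_A \<rho> (-1/2))"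

definition Omega ::
  "(complex^'a^'a \<Rightarrow> complex^'b^'b) \<Rightarrow> (complex^'a^'a \<Rightarrow> complex^'b^'b) \<Rightarrow>
   complex^'a^'a \<Rightarrow> complex^'a^'a" where
  "Omega N1 N2 \<rho> = (1/2) *\<^sub>R (Omega1 N1 N2 \<rho> + dagger (Omega1 N1 N2 \<rho>))"

definition neg_relative_entropy ::
  "(complex^'a^'a \<Rightarrow> complex^'b^'b) \<Rightarrow> (complex^'a^'a \<Rightarrow> complex^'b^'b) \<Rightarrow>
   complex^'a^'a \<Rightarrow> real" where
  "neg_relative_entropy N1 N2 \<rho> =
     - relative_entropy (sandwiched_choi N1 \<rho>) (sandwiched_choi N2 \<rho>)"

definition pauli_x :: "complex^2^2" where
  "pauli_x = vector [vector [0, 1], vector [1, 0]]"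

definition pauli_y :: "complex^2^2" where
  "pauli_y = vector [vector [0, - \<i>], vector [\<i>, 0]]"

definition pauli_z :: "complex^2^2" where
  "pauli_z = vector [vector [1, 0], vector [0, - 1]]"

definition dephasing :: "real \<Rightarrow> complex^2^2 \<Rightarrow> complex^2^2" where
  "dephasing q \<rho> = q *\<^sub>R \<rho> + (1 - q) *\<^sub>R (pauli_z ** \<rho> ** pauli_z)"

definition depolarizing :: "real \<Rightarrow> complex^2^2 \<Rightarrow> complex^2^2" where
  "depolarizing p \<rho> = (1 - p) *\<^sub>R \<rho> + p *\<^sub>R mat (trace \<rho> / 2)"


section \<open>Gradient\<close>

text \<open>
  \<open>G\<close> is a gradient at \<open>\<rho>\<close> of a function on density operators, with respect to the
  Hilbert-Schmidt inner product. The Frechet derivative is taken along the set of density operators,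
  so for positive definite \<open>\<rho>\<close> it is determined exactly on the traceless Hermitian matrices, and
  \<open>G\<close> is determined up to real multiples of the identity.
\<close>

definition is_gradient :: "(complex^'n^'n \<Rightarrow> real) \<Rightarrow> complex^'n^'n \<Rightarrow> complex^'n^'n \<Rightarrow> bool" where
  "is_gradient f \<rho> G \<longleftrightarrow> hermitian G \<and>
     (\<exists>D. (f has_derivative D) (at \<rho> within {\<sigma>. density_operator \<sigma>}) \<and>
          (\<forall>X. hermitian X \<and> trace X = 0 \<longrightarrow> complex_of_real (D X) = trace (X ** G)))"

end

theory Submission
  imports Defs
begin

text \<open>
  Write \<open>\<rho> = (1 + R)/2\<close> with \<open>R = r \<cdot> \<sigma>\<close>, put \<open>s = |r|\<^sup>2\<close>, and identify vectors of the tensor product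
  with matrices. Each sandwiched Choi matrix maps \<open>vec(\<rho>\<^sup>1\<^sup>/\<^sup>2 B)\<close> to \<open>vec(\<rho>\<^sup>1\<^sup>/\<^sup>2 T(B))\<close> for an explicit
  linear map \<open>T\<close> on \<open>2 \<times> 2\<close> matrices. The relevant \<open>B\<close>, namely \<open>1\<close> and \<open>\<sigma>\<^sub>z\<close>, are sums of elements of
  \<open>T\<close>-invariant planes, on which the logarithm is an affine function of \<open>T\<close> interpolating between two
  explicit eigenvalues. Hence \<open>f\<close> and the components of \<open>\<Omega>\<close> are explicit functions of \<open>r\<close>.

  For \<open>j \<in> {x, y}\<close> one finds that \<open>Tr(\<sigma>\<^sub>j (\<Omega> - \<nabla>f))\<close> is \<open>2 r\<^sub>j\<close> times a scalar, the mismatch, that depends only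
  on \<open>s\<close> and \<open>r\<^sub>z\<^sup>2\<close>. If \<open>H\<close> is \<open>\<sigma>\<^sub>x\<close> or \<open>\<sigma>\<^sub>y\<close>, take \<open>r\<^sub>z = 0\<close>; there the mismatch is positive because
  \<open>artanh u > u\<close>. If \<open>H = \<sigma>\<^sub>z\<close>, then \<open>r\<^sub>z = E\<close> is prescribed but \<open>s \<in> (E\<^sup>2, 1)\<close> is free: for \<open>E\<^sup>2 \<le> 1/100\<close>
  the mismatch is positive at \<open>s = 153/308\<close>, and for larger \<open>E\<^sup>2\<close> it is negative as \<open>s\<close> tends to \<open>1\<close>.
\<close>

section \<open>The complex inner product, adjoints and diagonal matrices\<close>

definition cinner :: "complex^'n \<Rightarrow> complex^'n \<Rightarrow> complex" where
  "cinner v w = (\<Sum>i\<in>UNIV. cnj (v $ i) * w $ i)"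

lemma Re_cinner: "Re (cinner v w) = v \<bullet> w"
  by (simp add: cinner_def inner_vec_def inner_complex_def)

lemma cinner_add_right: "cinner v (w + u) = cinner v w + cinner v u"
  by (simp add: cinner_def algebra_simps sum.distrib)

lemma cinner_scaleR_right: "cinner v (c *\<^sub>R w) = of_real c * cinner v w"
  by (simp add: cinner_def sum_distrib_left scaleR_conv_of_real[where 'a=complex] algebra_simps)

lemma cinner_scaleR_left: "cinner (c *\<^sub>R v) w = of_real c * cinner v w"
  by (simp add: cinner_def sum_distrib_left scaleR_conv_of_real[where 'a=complex] algebra_simps)

lemma cinner_smult_left: "cinner (c *s v) w = cnj c * cinner v w"
  by (simp add: cinner_def sum_distrib_left algebra_simps)

lemma cnj_cinner: "cnj (cinner v w) = cinner w v"
  by (simp add: cinner_def mult.commute)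

lemma cinner_self: "cinner v v = of_real ((norm v)\<^sup>2)"
proof (rule complex_eqI)
  show "Re (cinner v v) = Re (of_real ((norm v)\<^sup>2))"
    by (simp add: Re_cinner power2_norm_eq_inner)
  have "cnj (cinner v v) = cinner v v" by (rule cnj_cinner)
  then show "Im (cinner v v) = Im (of_real ((norm v)\<^sup>2))"
    by (metis Im_complex_of_real Reals_cnj_iff complex_is_Real_iff)
qed

text \<open>The real inner product sees only \<open>Re (cinner v w)\<close>; pairing with
  \<open>\<i> *s v\<close> recovers the imaginary part. So complex orthogonality to v is real
  orthogonality to two vectors.\<close>

lemma cinner_eq_0_iff: "cinner v w = 0 \<longleftrightarrow> v \<bullet> w = 0 \<and> (\<i> *s v) \<bullet> w = 0"
proof -
  have "(\<i> *s v) \<bullet> w = Im (cinner v w)"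
    unfolding Re_cinner[symmetric] cinner_smult_left by simp
  then show ?thesis
    by (simp add: complex_eq_iff Re_cinner)
qed

lemma cinner_adjoint: "cinner v (A *v w) = cinner (dagger A *v v) w"
proof -
  have "cinner v (A *v w) = (\<Sum>i\<in>UNIV. \<Sum>j\<in>UNIV. cnj (v $ i) * A $ i $ j * w $ j)"
    by (simp add: cinner_def matrix_vector_mult_def sum_distrib_left mult.assoc)
  also have "\<dots> = (\<Sum>j\<in>UNIV. \<Sum>i\<in>UNIV. cnj (v $ i) * A $ i $ j * w $ j)"
    by (rule sum.swap)
  also have "\<dots> = cinner (dagger A *v v) w"
    by (simp add: cinner_def matrix_vector_mult_def sum_distrib_left sum_distrib_right dagger_def
        mult_ac)
  finally show ?thesis .
qed

lemma quad_form_eq_cinner: "quad_form A v = cinner v (A *v v)"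
  by (simp add: quad_form_def cinner_def)

lemma dagger_dagger [simp]: "dagger (dagger A) = A"
  by (simp add: dagger_def vec_eq_iff)

lemma dagger_mult: "dagger (A ** B) = dagger B ** dagger A"
  by (simp add: dagger_def matrix_matrix_mult_def vec_eq_iff mult.commute)

lemma dagger_add: "dagger (A + B) = dagger A + dagger B"
  by (simp add: dagger_def vec_eq_iff)

lemma dagger_diff: "dagger (A - B) = dagger A - dagger B"
  by (simp add: dagger_def vec_eq_iff)

lemma dagger_real_diag [simp]: "dagger (real_diag d) = real_diag d"
  by (auto simp: dagger_def real_diag_def vec_eq_iff)

lemma trace_dagger: "trace (dagger A) = cnj (trace A)"
  by (simp add: trace_def dagger_def)

lemma real_diag_mult_nth: "(real_diag d ** M) $ i $ j = of_real (d i) * M $ i $ j"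
  by (simp add: real_diag_def matrix_matrix_mult_def if_distrib[of "\<lambda>x. x * _"] cong: if_cong)

lemma mult_real_diag_nth: "(M ** real_diag d) $ i $ j = M $ i $ j * of_real (d j)"
  by (simp add: real_diag_def matrix_matrix_mult_def if_distrib[of "\<lambda>x. _ * x"] cong: if_cong)

lemma real_diag_mult_vec_nth: "(real_diag d *v v) $ i = of_real (d i) * v $ i"
  by (simp add: real_diag_def matrix_vector_mult_def if_distrib[of "\<lambda>x. x * _"] cong: if_cong)

lemma matrix_vector_mult_scaleR_right:
  "A *v (c *\<^sub>R v) = c *\<^sub>R (A *v v)" for A :: "complex^'n^'m"
  by (simp add: matrix_vector_mult_def vec_eq_iff scaleR_sum_right)

lemma linear_matrix_vector_mult: "linear ((*v) A)" for A :: "complex^'n^'m"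
  by (rule linearI) (simp_all add: matrix_vector_right_distrib matrix_vector_mult_scaleR_right)

section \<open>The spectral theorem\<close>

text \<open>Rayleigh quotient argument: \<open>u \<bullet> T u\<close> attains its maximum l on the
  compact unit sphere of V, and at a maximizer the residual w must vanish. Working inside an
  invariant V allows repetition on orthogonal complements.\<close>

lemma selfadjoint_eigenvector_in_subspace:
  fixes T :: "'a::euclidean_space \<Rightarrow> 'a"
  assumes "linear T" and adj: "\<And>u v. u \<bullet> T v = T u \<bullet> v"
    and "subspace V" and inv: "\<And>v. v \<in> V \<Longrightarrow> T v \<in> V" and "v0 \<in> V" "v0 \<noteq> 0"
  obtains v l where "v \<in> V" "norm v = 1" "T v = l *\<^sub>R v"
proof -
  interpret T: linear T by fact
  let ?K = "V \<inter> sphere 0 1"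
  have "compact ?K"
    by (rule closed_Int_compact) (simp_all add: closed_subspace \<open>subspace V\<close>)
  moreover have "v0 /\<^sub>R norm v0 \<in> ?K"
    using assms by (simp add: subspace_scale)
  moreover have "continuous_on ?K (\<lambda>v. v \<bullet> T v)"
    using linear_continuous_on[OF linear_conv_bounded_linear[THEN iffD1, OF \<open>linear T\<close>]]
    by (intro continuous_on_inner continuous_on_id)
  ultimately obtain v where v: "v \<in> ?K" and max: "\<And>u. u \<in> ?K \<Longrightarrow> u \<bullet> T u \<le> v \<bullet> T v"
    using continuous_attains_sup[of ?K "\<lambda>v. v \<bullet> T v"] by blast
  define l where "l = v \<bullet> T v"
  have v1: "v \<in> V" "norm v = 1" using v by auto
  have bound: "u \<bullet> T u \<le> l * (u \<bullet> u)" if "u \<in> V" for u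
  proof (cases "u = 0")
    case True
    then show ?thesis by (simp add: T.zero)
  next
    case False
    have "(u /\<^sub>R norm u) \<bullet> T (u /\<^sub>R norm u) \<le> l"
      unfolding l_def using False that \<open>subspace V\<close> by (intro max) (simp add: subspace_scale)
    then have "(u \<bullet> T u) / (norm u)\<^sup>2 \<le> l"
      by (simp add: T.scale power2_eq_square divide_inverse mult_ac)
    then show ?thesis
      using False by (simp add: power2_norm_eq_inner[symmetric] pos_divide_le_eq)
  qed
  define w where "w = T v - l *\<^sub>R v"
  have wV: "w \<in> V"
    unfolding w_def using v1 assms(3) inv by (intro subspace_diff subspace_scale) auto
  define n where "n = w \<bullet> w"
  define k where "k = l * (w \<bullet> w) - w \<bullet> T w"
  \<comment> \<open>The bound is applied to a perturbation of v along w. The terms of order zero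
    cancel because \<open>v \<bullet> T v\<close> is l, leaving a first-order gain against a
    second-order loss.\<close>
  have ineq: "2 * e * n \<le> e\<^sup>2 * k" for e :: real
  proof -
    have "(v + e *\<^sub>R w) \<bullet> T (v + e *\<^sub>R w) \<le> l * ((v + e *\<^sub>R w) \<bullet> (v + e *\<^sub>R w))"
      using wV v1 \<open>subspace V\<close> by (intro bound subspace_add subspace_scale)
    moreover have "v \<bullet> T w = T v \<bullet> w" by (rule adj)
    moreover have "v \<bullet> v = 1" using v1 by (simp add: power2_norm_eq_inner[symmetric])
    moreover have "n = T v \<bullet> w - l * (v \<bullet> w)"
      by (simp add: n_def w_def[of] inner_diff_left)
    moreover have "w \<bullet> v = v \<bullet> w" "w \<bullet> T v = T v \<bullet> w" by (rule inner_commute)+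
    ultimately have "l + 2 * e * (T v \<bullet> w) + e\<^sup>2 * (w \<bullet> T w)
        \<le> l * (1 + 2 * e * (v \<bullet> w) + e\<^sup>2 * (w \<bullet> w))" and Tvw: "T v \<bullet> w = n + l * (v \<bullet> w)"
      by (simp_all add: T.add T.scale inner_add_left inner_add_right l_def[symmetric]
          power2_eq_square algebra_simps)
    then show ?thesis
      unfolding Tvw k_def by (simp add: algebra_simps)
  qed
  have "n = 0"
  proof (rule ccontr)
    assume "n \<noteq> 0"
    then have n: "n > 0" by (simp add: n_def)
    \<comment> \<open>Small enough that \<open>e * k \<le> n\<close>, whereas \<open>ineq\<close>
      divided by e demands \<open>2 * n \<le> e * k\<close>.\<close>
    define e where "e = n / (\<bar>k\<bar> + 1)"
    have e: "e > 0" using n by (simp add: e_def)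
    have "2 * n \<le> e * k"
      using ineq[of e] e by (simp add: power2_eq_square)
    also have "\<dots> \<le> e * (\<bar>k\<bar> + 1)" using e by (intro mult_left_mono) auto
    also have "\<dots> = n" by (simp add: e_def)
    finally show False using n by simp
  qed
  then have "T v = l *\<^sub>R v" by (simp add: n_def w_def)
  with v1 show thesis by (rule that)
qed

text \<open>Induction on the number of vectors. Since A is Hermitian, the complement of the
  eigenvectors found so far is A-invariant, and the previous lemma yields the next one there; its
  eigenvalue is real because that lemma works in the real Euclidean structure.\<close>

lemma hermitian_orthonormal_eigenvectors:
  fixes A :: "complex^'n^'n"
  assumes A: "hermitian A" and "k \<le> CARD('n)"
  shows "\<exists>B. finite B \<and> card B = k \<and>
    (\<forall>u\<in>B. \<forall>v\<in>B. cinner u v = (if u = v then 1 else 0)) \<and>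
    (\<forall>u\<in>B. \<exists>l::real. A *v u = l *\<^sub>R u)"
  using assms(2)
proof (induction k)
  case 0
  show ?case by (rule exI[of _ "{}"]) simp
next
  case (Suc k)
  then obtain B where B: "finite B" "card B = k"
    "\<And>u v. u \<in> B \<Longrightarrow> v \<in> B \<Longrightarrow> cinner u v = (if u = v then 1 else 0)"
    "\<And>u. u \<in> B \<Longrightarrow> \<exists>l::real. A *v u = l *\<^sub>R u"
    by auto
  have adj: "cinner u (A *v v) = cinner (A *v u) v" for u v
    using A by (simp add: cinner_adjoint hermitian_def)
  \<comment> \<open>Over the reals, \<open>?S\<close> spans the complex span of B, so its dimension
    is at most \<open>2 * k\<close>, below the real dimension of the whole space.\<close>
  let ?S = "B \<union> (\<lambda>u. \<i> *s u) ` B"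
  have "dim ?S \<le> card ?S" using B by (intro dim_le_card') auto
  also have "\<dots> \<le> card B + card ((\<lambda>u. \<i> *s u) ` B)" by (rule card_Un_le)
  also have "\<dots> \<le> 2 * k" using card_image_le[OF B(1), of "\<lambda>u. \<i> *s u"] B by simp
  also have "\<dots> < DIM(complex^'n)" using Suc.prems by simp
  finally obtain v0 where v0: "v0 \<noteq> 0" "\<And>y. y \<in> span ?S \<Longrightarrow> orthogonal v0 y"
    using orthogonal_to_subspace_exists by blast
  let ?V = "{v. \<forall>u\<in>B. cinner u v = 0}"
  have v0V: "v0 \<in> ?V"
  proof safe
    fix u assume u: "u \<in> B"
    then have "orthogonal v0 u" "orthogonal v0 (\<i> *s u)"
      by (intro v0(2) span_base; simp)+
    then show "cinner u v0 = 0"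
      by (simp add: cinner_eq_0_iff orthogonal_def inner_commute)
  qed
  have sub: "subspace ?V"
    by (auto simp: subspace_def cinner_add_right cinner_scaleR_right)
      (simp add: cinner_def)
  have inv: "A *v v \<in> ?V" if "v \<in> ?V" for v
  proof safe
    fix u assume u: "u \<in> B"
    then obtain l :: real where "A *v u = l *\<^sub>R u" using B(4) by blast
    then show "cinner u (A *v v) = 0"
      using that u by (simp add: adj cinner_scaleR_left)
  qed
  have adjR: "u \<bullet> (A *v v) = (A *v u) \<bullet> v" for u v
    using adj[of u v] by (metis Re_cinner)
  obtain v l where v: "v \<in> ?V" "norm v = 1" "A *v v = l *\<^sub>R v"
    by (rule selfadjoint_eigenvector_in_subspace[OF linear_matrix_vector_mult adjR sub inv v0V v0(1)])
  have vv: "cinner v v = 1" using v by (simp add: cinner_self)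
  have uv: "cinner u v = 0" "cinner v u = 0" if "u \<in> B" for u
    using v(1) that cnj_cinner[of u v] by auto
  have vB: "v \<notin> B" using vv uv(1)[of v] by auto
  show ?case
  proof (intro exI[of _ "insert v B"] conjI ballI)
    show "finite (insert v B)" "card (insert v B) = Suc k"
      using B(1,2) vB by simp_all
    show "cinner u u' = (if u = u' then 1 else 0)" if "u \<in> insert v B" "u' \<in> insert v B" for u u'
      using that B(3) vv uv vB by (cases "u = v"; cases "u' = v") auto
    show "\<exists>l::real. A *v u = l *\<^sub>R u" if "u \<in> insert v B" for u
      using that B(4) v(3) by auto
  qed
qed

lemma unitary_cancel:
  assumes "unitary U"
  shows "dagger U ** U = mat 1" "U ** dagger U = mat 1"
    and "dagger U ** (U ** X) = X" "U ** (dagger U ** X) = X"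
    and "dagger U *v (U *v v) = v" "U *v (dagger U *v v) = v"
  using assms by (simp_all add: unitary_def matrix_mul_assoc matrix_vector_mul_assoc)

lemma hermitian_spectral_decomposition:
  fixes A :: "complex^'n^'n"
  assumes "hermitian A"
  obtains U d where "unitary U" "A = U ** real_diag d ** dagger U"
proof -
  obtain B where B: "finite B" "card B = CARD('n)"
    "\<And>u v. u \<in> B \<Longrightarrow> v \<in> B \<Longrightarrow> cinner u v = (if u = v then 1 else 0)"
    "\<And>u. u \<in> B \<Longrightarrow> \<exists>l::real. A *v u = l *\<^sub>R u"
    using hermitian_orthonormal_eigenvectors[OF assms order_refl] by blast
  obtain h where h: "bij_betw h (UNIV::'n set) B"
    using finite_same_card_bij[OF finite B(1) B(2)[symmetric]] by blast
  then have hB: "h j \<in> B" and hinj: "h i = h j \<longleftrightarrow> i = j" for i j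
    by (auto simp: bij_betw_def inj_on_def)
  have "\<forall>j. \<exists>l::real. A *v h j = l *\<^sub>R h j" using B(4)[OF hB] by blast
  then obtain d :: "'n \<Rightarrow> real" where d: "\<And>j. A *v h j = d j *\<^sub>R h j"
    unfolding choice_iff by blast
  define U where "U = (\<chi> i j. h j $ i)"
  have "(dagger U ** U) $ i $ j = cinner (h i) (h j)" for i j
    by (simp add: U_def dagger_def matrix_matrix_mult_def cinner_def)
  then have "(dagger U ** U) $ i $ j = mat 1 $ i $ j" for i j
    by (simp add: B(3)[OF hB hB] mat_def hinj)
  then have "dagger U ** U = mat 1"
    by (simp only: vec_eq_iff simp_thms)
  then have U: "unitary U"
    by (simp add: unitary_def matrix_left_right_inverse)
  have "A ** U = U ** real_diag d"
  proof -
    have "(A ** U) $ i $ j = (U ** real_diag d) $ i $ j" for i j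
    proof -
      have "(A ** U) $ i $ j = (A *v h j) $ i"
        by (simp add: U_def matrix_matrix_mult_def matrix_vector_mult_def)
      then show ?thesis
        by (simp add: d mult_real_diag_nth) (simp add: U_def scaleR_conv_of_real mult.commute)
    qed
    then show ?thesis by (simp add: vec_eq_iff)
  qed
  then have "A ** U ** dagger U = U ** real_diag d ** dagger U" by simp
  then have "A = U ** real_diag d ** dagger U"
    by (simp only: matrix_mul_assoc[symmetric, of A U] unitary_cancel[OF U] matrix_mul_rid)
  with U show thesis by (rule that)
qed

section \<open>Functional calculus\<close>

text \<open>The unitary \<open>W\<close> intertwines the two diagonal matrices, so
  \<open>W $ i $ j\<close> can be nonzero only where \<open>d j = e i\<close>; hence it also
  intertwines their images under g. This makes the definite description in \<open>matrix_fun\<close>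
  meaningful.\<close>

lemma functional_calculus_unique:
  assumes U: "unitary U" and V: "unitary V"
    and eq: "U ** real_diag d ** dagger U = V ** real_diag e ** dagger V"
  shows "U ** real_diag (g \<circ> d) ** dagger U = V ** real_diag (g \<circ> e) ** dagger V"
proof -
  define W where "W = dagger V ** U"
  note cancel = unitary_cancel[OF U] unitary_cancel[OF V] matrix_mul_assoc[symmetric]
  have "dagger V ** (U ** real_diag d ** dagger U) ** U
      = dagger V ** (V ** real_diag e ** dagger V) ** U"
    by (simp add: eq)
  then have "W ** real_diag d = real_diag e ** W"
    by (simp add: W_def cancel)
  then have eq_nth: "W $ i $ j * of_real (d j) = of_real (e i) * W $ i $ j" for i j
    by (metis mult_real_diag_nth real_diag_mult_nth)
  have "W $ i $ j * of_real (g (d j)) = of_real (g (e i)) * W $ i $ j" for i j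
  proof (cases "W $ i $ j = 0")
    case False
    then have "d j = e i" using eq_nth[of i j] by simp
    then show ?thesis by simp
  qed simp
  then have "W ** real_diag (g \<circ> d) = real_diag (g \<circ> e) ** W"
    by (simp add: vec_eq_iff mult_real_diag_nth real_diag_mult_nth)
  then have "V ** (W ** real_diag (g \<circ> d)) ** dagger U
      = V ** (real_diag (g \<circ> e) ** W) ** dagger U"
    by simp
  then show ?thesis
    by (simp add: W_def cancel)
qed

lemma matrix_fun_decomposition:
  assumes "unitary U"
  shows "matrix_fun g (U ** real_diag d ** dagger U) = U ** real_diag (g \<circ> d) ** dagger U"
  unfolding matrix_fun_def
proof (rule the_equality)
  show "\<exists>Ua da. unitary Ua \<and> U ** real_diag d ** dagger U = Ua ** real_diag da ** dagger Ua \<and>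
      U ** real_diag (g \<circ> d) ** dagger U = Ua ** real_diag (g \<circ> da) ** dagger Ua"
    using assms by blast
next
  fix B
  assume "\<exists>V e. unitary V \<and> U ** real_diag d ** dagger U = V ** real_diag e ** dagger V \<and>
      B = V ** real_diag (g \<circ> e) ** dagger V"
  then obtain V e where V: "unitary V" "U ** real_diag d ** dagger U = V ** real_diag e ** dagger V"
      "B = V ** real_diag (g \<circ> e) ** dagger V"
    by blast
  show "B = U ** real_diag (g \<circ> d) ** dagger U"
    unfolding V(3) by (rule functional_calculus_unique[OF assms V(1,2), symmetric])
qed

lemma hermitian_matrix_fun:
  assumes "hermitian A"
  shows "hermitian (matrix_fun g A)"
proof -
  obtain U d where "unitary U" "A = U ** real_diag d ** dagger U"
    using hermitian_spectral_decomposition[OF assms] .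
  then show ?thesis
    by (simp add: matrix_fun_decomposition hermitian_def dagger_mult matrix_mul_assoc)
qed

text \<open>
  A vector annihilated by \<open>(A - k\<^sub>1)(A - k\<^sub>2)\<close> only has components in the eigenspaces of \<open>k\<^sub>1\<close> and
  \<open>k\<^sub>2\<close>, so on it \<open>g(A)\<close> agrees with the affine interpolation of \<open>g\<close> at these two points.
\<close>

lemma matrix_fun_mult_vec_interpolate:
  fixes A :: "complex^'n^'n"
  assumes "hermitian A"
    and quadratic: "A *v (A *v v) = (k1 + k2) *\<^sub>R (A *v v) - (k1 * k2) *\<^sub>R v"
    and g: "g k1 = \<alpha> + \<beta> * k1" "g k2 = \<alpha> + \<beta> * k2"
  shows "matrix_fun g A *v v = \<alpha> *\<^sub>R v + \<beta> *\<^sub>R (A *v v)"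
proof -
  obtain U d where U: "unitary U" and A: "A = U ** real_diag d ** dagger U"
    using hermitian_spectral_decomposition[OF assms(1)] .
  define x where "x = dagger U *v v"
  have Ux: "U *v x = v"
    by (simp add: x_def unitary_cancel[OF U])
  have AU: "A *v (U *v u) = U *v (real_diag d *v u)" for u
    by (simp add: A matrix_vector_mul_assoc[symmetric] unitary_cancel[OF U])
  have U_inj: "u = u'" if "U *v u = U *v u'" for u u'
    using arg_cong[OF that, of "(*v) (dagger U)"] by (simp add: unitary_cancel[OF U])
  have "U *v (real_diag d *v (real_diag d *v x))
      = U *v ((k1 + k2) *\<^sub>R (real_diag d *v x) - (k1 * k2) *\<^sub>R x)"
    using quadratic unfolding Ux[symmetric] AU
    by (simp add: matrix_vector_mult_scaleR_right matrix_vector_mult_diff_distrib)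
  then have eq: "real_diag d *v (real_diag d *v x)
      = (k1 + k2) *\<^sub>R (real_diag d *v x) - (k1 * k2) *\<^sub>R x"
    by (rule U_inj)
  have "of_real (g (d i)) * x $ i = of_real (\<alpha> + \<beta> * d i) * x $ i" for i
  proof -
    have "of_real (d i) * (of_real (d i) * x $ i)
        = of_real (k1 + k2) * (of_real (d i) * x $ i) - of_real (k1 * k2) * x $ i"
      using arg_cong[OF eq, of "\<lambda>u. u $ i"]
      by (simp add: real_diag_mult_vec_nth scaleR_conv_of_real[where 'a=complex])
    then have "of_real ((d i - k1) * (d i - k2)) * x $ i = 0"
      by (simp add: algebra_simps)
    then have "x $ i = 0 \<or> d i = k1 \<or> d i = k2"
      by (auto simp only: mult_eq_0_iff of_real_eq_0_iff right_minus_eq)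
    then show ?thesis using g by auto
  qed
  then have "real_diag (g \<circ> d) *v x = \<alpha> *\<^sub>R x + \<beta> *\<^sub>R (real_diag d *v x)"
    by (simp add: vec_eq_iff real_diag_mult_vec_nth scaleR_conv_of_real[where 'a=complex] algebra_simps)
  then have "U *v (real_diag (g \<circ> d) *v x) = \<alpha> *\<^sub>R (U *v x) + \<beta> *\<^sub>R (U *v (real_diag d *v x))"
    by (simp add: matrix_vector_right_distrib matrix_vector_mult_scaleR_right)
  moreover have "matrix_fun g A *v v = U *v (real_diag (g \<circ> d) *v x)"
    by (simp add: A matrix_fun_decomposition[OF U] x_def matrix_vector_mul_assoc[symmetric])
  ultimately show ?thesis
    by (simp add: Ux AU[symmetric])
qed

lemma positive_definite_eigenvalues_pos:
  assumes "positive_definite (U ** real_diag d ** dagger U)" "unitary U"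
  shows "0 < d i"
proof -
  define v where "v = U *v axis i 1"
  have Uv: "dagger U *v v = axis i 1"
    using assms(2) by (simp add: v_def matrix_vector_mul_assoc unitary_def)
  then have "v \<noteq> 0" by (metis axis_eq_0_iff matrix_vector_mult_0_right zero_neq_one)
  then have "0 < Re (quad_form (U ** real_diag d ** dagger U) v)"
    using assms(1) by (auto simp: positive_definite_def)
  also have "quad_form (U ** real_diag d ** dagger U) v
      = cinner (dagger U *v v) (real_diag d *v (dagger U *v v))"
    by (simp add: quad_form_eq_cinner matrix_vector_mul_assoc[symmetric] cinner_adjoint[of v U])
  also have "\<dots> = (\<Sum>j\<in>UNIV. if j = i then of_real (d i) else 0)"
    unfolding Uv cinner_def
    by (intro sum.cong) (auto simp: real_diag_mult_vec_nth axis_def)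
  finally show ?thesis by simp
qed

text \<open>Positivity of the eigenvalues matters: \<open>0 powr 0\<close> is \<open>0\<close>, so
  on a kernel the zeroth power would not be the identity.\<close>

lemma matrix_power_add:
  assumes "positive_definite A"
  shows "matrix_power A s ** matrix_power A t = matrix_power A (s + t)"
    and "matrix_power A 0 = mat 1" and "matrix_power A 1 = A"
proof -
  obtain U d where U: "unitary U" and A: "A = U ** real_diag d ** dagger U"
    using hermitian_spectral_decomposition[of A] assms positive_definite_def by metis
  have d: "0 < d i" for i
    using assms U positive_definite_eigenvalues_pos unfolding A by blast
  let ?g = "\<lambda>s x. x powr s"
  have P: "matrix_power A s = U ** real_diag (?g s \<circ> d) ** dagger U" for s
    unfolding matrix_power_def A by (rule matrix_fun_decomposition[OF U])
  have "matrix_power A s ** matrix_power A t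
      = U ** (real_diag (?g s \<circ> d) ** (dagger U ** U) ** real_diag (?g t \<circ> d)) ** dagger U"
    by (simp add: P matrix_mul_assoc)
  also have "real_diag (?g s \<circ> d) ** (dagger U ** U) ** real_diag (?g t \<circ> d)
      = real_diag (?g (s + t) \<circ> d)"
  proof -
    have "real_diag (?g s \<circ> d) ** real_diag (?g t \<circ> d) = real_diag (?g (s + t) \<circ> d)"
      by (simp add: vec_eq_iff real_diag_mult_nth) (simp add: real_diag_def powr_add)
    then show ?thesis
      by (simp add: unitary_cancel[OF U])
  qed
  finally show "matrix_power A s ** matrix_power A t = matrix_power A (s + t)"
    by (simp add: P)
  have "real_diag (?g 0 \<circ> d) = mat 1"
    using less_imp_neq[OF d] by (auto simp: real_diag_def mat_def vec_eq_iff powr_def)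
  then show "matrix_power A 0 = mat 1"
    using U by (simp add: P unitary_def)
  show "matrix_power A 1 = A"
  proof -
    have "?g 1 \<circ> d = d" using d by (auto simp: less_imp_le)
    then show ?thesis by (simp only: P A[symmetric])
  qed
qed

section \<open>Vectorization and Choi matrices\<close>

text \<open>The Hilbert-Schmidt identification: operators on the first factor become left
  multiplications (\<open>kron_mult_vec\<close>) and the inner product becomes
  \<open>trace (dagger A ** B)\<close> (\<open>cinner_vec_of\<close>).\<close>

definition vec_of :: "complex^'b^'a \<Rightarrow> complex^('a::finite \<times> 'b::finite)" where
  "vec_of A = (\<chi> r. A $ fst r $ snd r)"

definition outer :: "complex^'n \<Rightarrow> complex^'m \<Rightarrow> complex^'m^'n" where
  "outer v w = (\<chi> i j. v $ i * cnj (w $ j))"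

lemma sum_UNIV_prod: "(\<Sum>r\<in>UNIV. f r) = (\<Sum>i\<in>UNIV. \<Sum>j\<in>UNIV. f (i, j))"
  for f :: "'a::finite \<times> 'b::finite \<Rightarrow> 'c::comm_monoid_add"
  by (simp add: sum.cartesian_product)

lemma vec_of_add: "vec_of (A + B) = vec_of A + vec_of B"
  by (simp add: vec_of_def vec_eq_iff)

lemma vec_of_diff: "vec_of (A - B) = vec_of A - vec_of B"
  by (simp add: vec_of_def vec_eq_iff)

lemma vec_of_scaleR: "vec_of (c *\<^sub>R A) = c *\<^sub>R vec_of A"
  by (simp add: vec_of_def vec_eq_iff)

lemma kron_mult_vec: "kron X (mat 1) *v vec_of B = vec_of (X ** B)"
  by (simp add: kron_def vec_of_def matrix_vector_mult_def matrix_matrix_mult_def vec_eq_iff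
      sum_UNIV_prod mat_def if_distrib[of "\<lambda>x. _ * x"] if_distrib[of "\<lambda>x. x * _"] cong: if_cong)

lemma kron_mult: "kron A B ** kron C D = kron (A ** C) (B ** D)"
  by (simp add: kron_def matrix_matrix_mult_def vec_eq_iff sum_UNIV_prod sum_product mult_ac)

lemma dagger_kron: "dagger (kron A B) = kron (dagger A) (dagger B)"
  by (simp add: dagger_def kron_def vec_eq_iff)

lemma dagger_mat_1 [simp]: "dagger (mat 1) = mat 1"
  by (auto simp: dagger_def mat_def vec_eq_iff)

lemma cinner_vec_of: "cinner (vec_of A) (vec_of B) = trace (dagger A ** B)"
  unfolding cinner_def vec_of_def trace_def dagger_def matrix_matrix_mult_def
  by (simp add: sum_UNIV_prod) (rule sum.swap)

lemma outer_mult_vec: "outer v w *v u = cinner w u *s v"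
  by (simp add: outer_def cinner_def matrix_vector_mult_def vec_eq_iff sum_distrib_right
      sum_distrib_left mult_ac)

lemma trace_outer_mult: "trace (outer v w ** M) = cinner w (M *v v)"
proof -
  have "trace (outer v w ** M) = (\<Sum>i\<in>UNIV. \<Sum>j\<in>UNIV. cnj (w $ j) * M $ j $ i * v $ i)"
    by (simp add: trace_def outer_def matrix_matrix_mult_def mult_ac)
  also have "\<dots> = (\<Sum>j\<in>UNIV. \<Sum>i\<in>UNIV. cnj (w $ j) * M $ j $ i * v $ i)"
    by (rule sum.swap)
  also have "\<dots> = cinner w (M *v v)"
    by (simp add: cinner_def matrix_vector_mult_def sum_distrib_left mult.assoc)
  finally show ?thesis .
qed

lemma trace_scaleR: "trace (c *\<^sub>R A) = of_real c * trace A" for A :: "complex^'n^'n"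
  by (simp add: trace_def sum_distrib_left scaleR_conv_of_real[where 'a=complex])

lemma trace_uminus: "trace (- A) = - trace A" for A :: "complex^'n^'n"
  by (simp add: trace_def sum_negf)

lemma matrix_mult_uminus: "(- A) ** B = - (A ** B)" for A :: "complex^'n^'m"
  by (simp add: matrix_matrix_mult_def vec_eq_iff sum_negf)

lemma matrix_mult_scaleR:
  "(c *\<^sub>R A) ** B = c *\<^sub>R (A ** B)" "A ** (c *\<^sub>R B) = c *\<^sub>R (A ** B)"
  for A :: "complex^'n^'m"
  by (simp_all add: matrix_matrix_mult_def vec_eq_iff scaleR_sum_right)

lemma matrix_mult_add_rdistrib: "(A + B) ** C = A ** C + B ** C" for A :: "complex^'n^'m"
  by (simp add: matrix_matrix_mult_def vec_eq_iff algebra_simps sum.distrib)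

lemma matrix_mult_diff_ldistrib: "A ** (B - C) = A ** B - A ** C" for A :: "complex^'n^'m"
  by (simp add: matrix_matrix_mult_def vec_eq_iff algebra_simps sum_subtractf)

text \<open>Duality of the partial trace with tensoring by the identity; it moves traces against
  \<open>Omega1\<close> to the tensor product.\<close>

lemma trace_partial_trace_B: "trace (partial_trace_B M ** X) = trace (M ** kron X (mat 1))"
  unfolding trace_def partial_trace_B_def matrix_matrix_mult_def kron_def
  by (simp add: sum_UNIV_prod mat_def if_distrib[of "\<lambda>x. _ * x"] sum_distrib_right cong: if_cong)
    (intro sum.cong refl sum.swap)

lemma hermitianI: "dagger A = A \<Longrightarrow> hermitian A"
  and hermitianD: "hermitian A \<Longrightarrow> dagger A = A"
  by (simp_all add: hermitian_def)

lemma hermitian_matrix_power: "hermitian \<rho> \<Longrightarrow> hermitian (matrix_power \<rho> s)"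
  by (simp add: matrix_power_def hermitian_matrix_fun)

lemma hermitian_power_on_A: "hermitian \<rho> \<Longrightarrow> hermitian (power_on_A \<rho> s)"
  using hermitian_matrix_power[of \<rho> s] by (simp add: power_on_A_def hermitian_def dagger_kron)

lemma hermitian_sandwiched_choi:
  "hermitian \<rho> \<Longrightarrow> hermitian (choi N) \<Longrightarrow> hermitian (sandwiched_choi N \<rho>)"
  by (rule hermitianI) (simp add: sandwiched_choi_def dagger_mult hermitianD hermitian_power_on_A
      matrix_mul_assoc)

lemma hermitian_matrix_log: "hermitian A \<Longrightarrow> hermitian (matrix_log A)"
  by (simp add: matrix_log_def hermitian_matrix_fun)

section \<open>Traces of Omega1 and Omega, and f as Tr(\<rho> \<Omega>)\<close>

lemma trace_Omega1_mult:
  "trace (Omega1 N1 N2 \<rho> ** X) = - trace (choi N1 ** (power_on_A \<rho> (1/2) **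
     ((matrix_log (sandwiched_choi N1 \<rho>) - matrix_log (sandwiched_choi N2 \<rho>)) **
      (power_on_A \<rho> (-1/2) ** kron X (mat 1)))))"
  by (simp add: Omega1_def matrix_mult_uminus trace_uminus trace_partial_trace_B matrix_mul_assoc)

text \<open>Symmetrization replaces the trace against a Hermitian matrix by its real part, so it
  suffices to compute with \<open>Omega1\<close>.\<close>

lemma trace_hermitian_mult_Omega:
  assumes "hermitian X"
  shows "trace (X ** Omega N1 N2 \<rho>) = of_real (Re (trace (Omega1 N1 N2 \<rho> ** X)))"
proof -
  let ?t = "trace (Omega1 N1 N2 \<rho> ** X)"
  have "trace (X ** dagger (Omega1 N1 N2 \<rho>)) = trace (dagger (Omega1 N1 N2 \<rho> ** X))"
    using assms by (simp add: dagger_mult hermitian_def)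
  then have "trace (X ** Omega N1 N2 \<rho>) = (1/2) * (?t + cnj ?t)"
    by (simp add: Omega_def matrix_mult_scaleR trace_scaleR matrix_add_ldistrib trace_add
        trace_dagger trace_mul_sym[of X "Omega1 N1 N2 \<rho>"])
  then show ?thesis by (simp add: complex_add_cnj)
qed

text \<open>Multiplication by \<rho> turns the factor \<rho>^(-1/2) into \<rho>^(1/2), and cyclicity
  then forms the sandwiched Choi matrix.\<close>

lemma trace_Omega1_state:
  assumes "positive_definite \<rho>"
  shows "trace (Omega1 N1 N2 \<rho> ** \<rho>) = - trace (sandwiched_choi N1 \<rho> **
    (matrix_log (sandwiched_choi N1 \<rho>) - matrix_log (sandwiched_choi N2 \<rho>)))"
proof -
  have "matrix_power \<rho> (-1/2) ** \<rho> = matrix_power \<rho> (1/2)"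
    using matrix_power_add(1)[OF assms, of "-1/2" 1] matrix_power_add(3)[OF assms] by simp
  then have S: "power_on_A \<rho> (-1/2) ** kron \<rho> (mat 1) = power_on_A \<rho> (1/2)"
    by (simp add: power_on_A_def kron_mult)
  have comm: "trace (choi N1 ** (power_on_A \<rho> (1/2) ** (L ** power_on_A \<rho> (1/2))))
      = trace (power_on_A \<rho> (1/2) ** (choi N1 ** (power_on_A \<rho> (1/2) ** L)))" for L
    using trace_mul_sym[of "power_on_A \<rho> (1/2)" "choi N1 ** (power_on_A \<rho> (1/2) ** L)"]
    by (simp add: matrix_mul_assoc)
  show ?thesis
    unfolding trace_Omega1_mult S comm by (simp add: sandwiched_choi_def matrix_mul_assoc)
qed

lemma neg_relative_entropy_eq_trace_Omega:
  assumes "positive_definite \<rho>"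
  shows "of_real (neg_relative_entropy N1 N2 \<rho>) = trace (\<rho> ** Omega N1 N2 \<rho>)"
    and "neg_relative_entropy N1 N2 \<rho> = Re (trace (Omega1 N1 N2 \<rho> ** \<rho>))"
  using assms
  by (simp_all add: trace_hermitian_mult_Omega positive_definite_def trace_Omega1_state
      neg_relative_entropy_def relative_entropy_def)

section \<open>The dephasing and depolarizing channels\<close>

lemma choi_nth: "choi N $ (i, k) $ (j, l) = N (ketbra i j) $ k $ l"
proof -
  have "ketbra i' j' $ i $ j = (if j' = j then if i' = i then 1 else 0 else 0)" for i' j'
    by (simp add: ketbra_def eq_commute)
  then show ?thesis
    by (simp add: choi_def kron_def if_distrib[of "\<lambda>x. x * _"] cong: if_cong)
qed

text \<open>The Kraus operators are multiples of 1 and \<sigma>_z, so the Choi matrix has rank at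
  most two, with range in the span of their vectorizations.\<close>

lemma choi_dephasing:
  "choi (dephasing q) = q *\<^sub>R outer (vec_of (mat 1)) (vec_of (mat 1))
    + (1 - q) *\<^sub>R outer (vec_of pauli_z) (vec_of pauli_z)"
  by (simp add: vec_eq_iff choi_nth dephasing_def outer_def vec_of_def forall_2 pauli_z_def ketbra_def
      matrix_matrix_mult_def sum_2 mat_def scaleR_conv_of_real[where 'a=complex] algebra_simps)

lemma choi_depolarizing:
  "choi (depolarizing p) = (1 - p) *\<^sub>R outer (vec_of (mat 1)) (vec_of (mat 1)) + (p/2) *\<^sub>R mat 1"
  by (simp add: vec_eq_iff choi_nth depolarizing_def outer_def vec_of_def forall_2 ketbra_def
      trace_def sum_2 mat_def scaleR_conv_of_real[where 'a=complex] algebra_simps)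

lemma hermitian_choi_dephasing: "hermitian (choi (dephasing q))"
  by (simp add: hermitian_def choi_dephasing dagger_def outer_def vec_eq_iff mult.commute)

lemma hermitian_choi_depolarizing: "hermitian (choi (depolarizing p))"
  by (auto simp: hermitian_def choi_depolarizing dagger_def outer_def vec_eq_iff mat_def)

lemma matrix_vector_mult_scaleR_left: "(c *\<^sub>R A) *v v = c *\<^sub>R (A *v v)" for A :: "complex^'n^'m"
  by (simp add: matrix_vector_mult_def vec_eq_iff scaleR_sum_right)

lemma vec_of_smult_mat: "c *s vec_of A = vec_of (mat c ** A)"
  by (simp add: vec_of_def vec_eq_iff matrix_matrix_mult_def mat_def
      if_distrib[of "\<lambda>x. x * _"] cong: if_cong)

lemma sqrt_matrix:
  assumes "positive_definite \<rho>"
  shows "matrix_power \<rho> (1/2) ** matrix_power \<rho> (1/2) = \<rho>"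
    and "matrix_power \<rho> (1/2) ** matrix_power \<rho> (-1/2) = mat 1"
  using matrix_power_add[OF assms] by simp_all

text \<open>The two inner square roots multiply to \<rho>. So on vectors of the form vec(S B), with
  S the square root, the operator is described by \<rho> alone and S survives only as an outer
  factor that is never computed.\<close>

lemma sandwiched_choi_mult_vec:
  assumes "positive_definite \<rho>"
    and "choi N *v vec_of (\<rho> ** B) = vec_of C"
  shows "sandwiched_choi N \<rho> *v vec_of (matrix_power \<rho> (1/2) ** B) = vec_of (matrix_power \<rho> (1/2) ** C)"
  using assms(2)
  by (simp add: sandwiched_choi_def power_on_A_def matrix_vector_mul_assoc[symmetric] kron_mult_vec
      matrix_mul_assoc sqrt_matrix[OF assms(1)])

lemma sandwiched_dephasing_mult_vec:
  assumes "positive_definite \<rho>"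
  shows "sandwiched_choi (dephasing q) \<rho> *v vec_of (matrix_power \<rho> (1/2) ** B) =
    vec_of (matrix_power \<rho> (1/2) **
      (q *\<^sub>R mat (trace (\<rho> ** B)) + (1 - q) *\<^sub>R (mat (trace (pauli_z ** \<rho> ** B)) ** pauli_z)))"
proof (rule sandwiched_choi_mult_vec[OF assms])
  have "dagger pauli_z = pauli_z"
    by (simp add: pauli_z_def dagger_def vec_eq_iff forall_2)
  then show "choi (dephasing q) *v vec_of (\<rho> ** B) =
    vec_of (q *\<^sub>R mat (trace (\<rho> ** B)) + (1 - q) *\<^sub>R (mat (trace (pauli_z ** \<rho> ** B)) ** pauli_z))"
    by (simp add: choi_dephasing matrix_vector_mult_add_rdistrib matrix_vector_mult_scaleR_left
        outer_mult_vec cinner_vec_of vec_of_smult_mat vec_of_add vec_of_scaleR matrix_mul_assoc)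
qed

lemma sandwiched_depolarizing_mult_vec:
  assumes "positive_definite \<rho>"
  shows "sandwiched_choi (depolarizing p) \<rho> *v vec_of (matrix_power \<rho> (1/2) ** B) =
    vec_of (matrix_power \<rho> (1/2) ** ((1 - p) *\<^sub>R mat (trace (\<rho> ** B)) + (p/2) *\<^sub>R (\<rho> ** B)))"
  by (rule sandwiched_choi_mult_vec[OF assms])
    (simp add: choi_depolarizing matrix_vector_mult_add_rdistrib matrix_vector_mult_scaleR_left
        outer_mult_vec cinner_vec_of vec_of_smult_mat vec_of_add vec_of_scaleR)

text \<open>The dephasing Choi matrix consists of two rank-one terms, so only two matrix elements
  are needed. Moving the self-adjoint L and S to the left argument of \<open>cinner\<close> lets
  \<rho>^(1/2) cancel against \<rho>^(-1/2); what remains is the action of L on vec(S) and vec(S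
  \<sigma>_z).\<close>

lemma trace_Omega1_dephasing:
  fixes N2 :: "complex^2^2 \<Rightarrow> complex^2^2"
  assumes \<rho>: "positive_definite \<rho>" and N2: "hermitian (choi N2)"
    and S_def: "S = matrix_power \<rho> (1/2)"
    and L_def: "L = matrix_log (sandwiched_choi (dephasing q) \<rho>) - matrix_log (sandwiched_choi N2 \<rho>)"
    and Z1: "L *v vec_of S = vec_of (S ** Z1)"
    and Z2: "L *v vec_of (S ** pauli_z) = vec_of (S ** Z2)"
  shows "trace (Omega1 (dephasing q) N2 \<rho> ** X) =
    - (of_real q * trace (dagger Z1 ** X) + of_real (1 - q) * trace (dagger Z2 ** (X ** pauli_z)))"
proof -
  let ?K = "\<lambda>A. kron A (mat 1 :: complex^2^2)"
  let ?S' = "matrix_power \<rho> (-1/2)"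
  have h: "hermitian \<rho>" using \<rho> by (simp add: positive_definite_def)
  then have S: "dagger S = S"
    using hermitian_matrix_power[of \<rho> "1/2"] by (simp add: hermitian_def S_def)
  have L: "dagger L = L"
    using h N2 hermitian_choi_dephasing[of q]
    by (simp add: L_def dagger_diff hermitian_sandwiched_choi hermitian_matrix_log hermitianD)
  have eq: "cinner (vec_of Q) (?K S ** (L ** (?K ?S' ** ?K X)) *v vec_of Q) = trace (dagger Z ** (X ** Q))"
    if "L *v vec_of (S ** Q) = vec_of (S ** Z)" for Q Z
  proof -
    have "cinner (vec_of Q) (?K S ** (L ** (?K ?S' ** ?K X)) *v vec_of Q)
        = cinner (L *v vec_of (S ** Q)) (vec_of (?S' ** (X ** Q)))"
      by (simp add: matrix_vector_mul_assoc[symmetric] kron_mult_vec cinner_adjoint dagger_kron S L)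
    also have "\<dots> = trace (dagger Z ** (S ** ?S') ** (X ** Q))"
      by (simp add: that cinner_vec_of dagger_mult S matrix_mul_assoc)
    finally show ?thesis
      using sqrt_matrix(2)[OF \<rho>] by (simp add: S_def)
  qed
  have "trace (Omega1 (dephasing q) N2 \<rho> ** X)
      = - trace (choi (dephasing q) ** (?K S ** (L ** (?K ?S' ** ?K X))))"
    by (simp add: trace_Omega1_mult L_def power_on_A_def S_def)
  then show ?thesis
    using eq[of "mat 1" Z1] eq[of pauli_z Z2] Z1 Z2
    by (simp add: choi_dephasing matrix_mult_add_rdistrib matrix_mult_scaleR trace_add trace_scaleR
        trace_outer_mult)
qed

section \<open>Qubit states\<close>

definition pauli_vec :: "real \<Rightarrow> real \<Rightarrow> real \<Rightarrow> complex^2^2" where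
  "pauli_vec x y z = x *\<^sub>R pauli_x + y *\<^sub>R pauli_y + z *\<^sub>R pauli_z"

definition bloch :: "real \<Rightarrow> real \<Rightarrow> real \<Rightarrow> complex^2^2" where
  "bloch x y z = (1/2) *\<^sub>R (mat 1 + pauli_vec x y z)"

lemma pauli_x_nth [simp]: "pauli_x $ 1 $ 1 = 0" "pauli_x $ 1 $ 2 = 1" "pauli_x $ 2 $ 1 = 1" "pauli_x $ 2 $ 2 = 0"
  by (simp_all add: pauli_x_def)

lemma pauli_y_nth [simp]: "pauli_y $ 1 $ 1 = 0" "pauli_y $ 1 $ 2 = - \<i>" "pauli_y $ 2 $ 1 = \<i>" "pauli_y $ 2 $ 2 = 0"
  by (simp_all add: pauli_y_def)

lemma pauli_z_nth [simp]: "pauli_z $ 1 $ 1 = 1" "pauli_z $ 1 $ 2 = 0" "pauli_z $ 2 $ 1 = 0" "pauli_z $ 2 $ 2 = - 1"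
  by (simp_all add: pauli_z_def)

lemma mat_nth_2 [simp]:
  "(mat c :: complex^2^2) $ 1 $ 1 = c" "(mat c :: complex^2^2) $ 2 $ 2 = c"
  "(mat c :: complex^2^2) $ 1 $ 2 = 0" "(mat c :: complex^2^2) $ 2 $ 1 = 0"
  by (simp_all add: mat_def)

lemmas matrix_2_simps = vec_eq_iff forall_2 matrix_matrix_mult_def sum_2 trace_def dagger_def
  complex_eq_iff

lemma hermitian_pauli: "hermitian pauli_x" "hermitian pauli_y" "hermitian pauli_z"
  by (simp_all add: hermitian_def matrix_2_simps)

lemma hermitian_pauli_vec: "hermitian (pauli_vec x y z)"
  by (simp add: hermitian_def pauli_vec_def matrix_2_simps)

lemma hermitian_bloch: "hermitian (bloch x y z)"
  by (simp add: hermitian_def bloch_def pauli_vec_def matrix_2_simps)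

lemma pauli_vec_square:
  "pauli_vec x y z ** pauli_vec x y z = (x\<^sup>2 + y\<^sup>2 + z\<^sup>2) *\<^sub>R mat 1"
  by (simp add: pauli_vec_def matrix_2_simps power2_eq_square algebra_simps)

lemma trace_bloch: "trace (bloch x y z) = 1"
  by (simp add: bloch_def pauli_vec_def matrix_2_simps field_simps)

text \<open>The Bloch part R squares to s times the identity with s < 1, so it strictly shrinks
  norms, and by Cauchy-Schwarz its quadratic form is dominated by that of the identity.\<close>

lemma positive_definite_bloch:
  assumes "x\<^sup>2 + y\<^sup>2 + z\<^sup>2 < 1"
  shows "positive_definite (bloch x y z)"
  unfolding positive_definite_def
proof (intro conjI allI impI hermitian_bloch)
  fix v :: "complex^2" assume v: "v \<noteq> 0"
  let ?R = "pauli_vec x y z" and ?s = "x\<^sup>2 + y\<^sup>2 + z\<^sup>2"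
  have "(norm (?R *v v))\<^sup>2 = Re (cinner v (?R *v (?R *v v)))"
    using hermitian_pauli_vec[of x y z]
    by (simp add: cinner_adjoint[of v] hermitian_def Re_cinner power2_norm_eq_inner)
  also have "\<dots> = ?s * (norm v)\<^sup>2"
    by (simp add: matrix_vector_mul_assoc pauli_vec_square matrix_vector_mult_scaleR_left
        Re_cinner power2_norm_eq_inner)
  also have "\<dots> < (norm v)\<^sup>2"
    using assms v by simp
  finally have "norm (?R *v v) < norm v"
    by (rule power_less_imp_less_base) simp
  then have "norm v * norm (?R *v v) < norm v * norm v"
    using v by simp
  moreover have "\<bar>v \<bullet> (?R *v v)\<bar> \<le> norm v * norm (?R *v v)"
    by (rule Cauchy_Schwarz_ineq2)
  ultimately have "0 < v \<bullet> v + v \<bullet> (?R *v v)"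
    by (simp add: norm_eq_sqrt_inner)
  then show "0 < Re (quad_form (bloch x y z) v)"
    by (simp add: quad_form_eq_cinner Re_cinner bloch_def matrix_vector_mult_scaleR_left
        matrix_vector_mult_add_rdistrib inner_add_right)
qed

lemma density_operator_bloch:
  assumes "x\<^sup>2 + y\<^sup>2 + z\<^sup>2 < 1"
  shows "density_operator (bloch x y z)"
proof -
  have "0 \<le> Re (quad_form (bloch x y z) v)" for v
    using positive_definite_bloch[OF assms]
    by (cases "v = 0") (auto simp: positive_definite_def quad_form_def intro: less_imp_le)
  then show ?thesis
    by (simp add: density_operator_def positive_semidefinite_def hermitian_bloch trace_bloch)
qed

definition pauli_coord :: "complex^2^2 \<Rightarrow> complex^2^2 \<Rightarrow> real" where
  "pauli_coord P A = Re (trace (A ** P))"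

lemma bloch_pauli_coord:
  assumes "density_operator A"
  shows "A = bloch (pauli_coord pauli_x A) (pauli_coord pauli_y A) (pauli_coord pauli_z A)"
proof -
  have dag: "cnj (A $ j $ i) = A $ i $ j" for i j
    using assms
    by (metis (no_types, lifting) dagger_def density_operator_def hermitian_def
        positive_semidefinite_def vec_lambda_beta)
  have "A $ 1 $ 1 + A $ 2 $ 2 = 1"
    using assms by (simp add: density_operator_def trace_def sum_2)
  then have A: "Re (A $ 2 $ 2) = 1 - Re (A $ 1 $ 1)" "Im (A $ 1 $ 1) = 0" "Im (A $ 2 $ 2) = 0"
    "Re (A $ 1 $ 2) = Re (A $ 2 $ 1)" "Im (A $ 1 $ 2) = - Im (A $ 2 $ 1)"
    using dag[of 1 1] dag[of 2 2] dag[of 2 1] by (simp_all add: complex_eq_iff)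
  show ?thesis
    by (simp add: bloch_def pauli_vec_def pauli_coord_def matrix_2_simps A field_simps)
qed

lemma pauli_coord_bloch:
  "pauli_coord pauli_x (bloch x y z) = x" "pauli_coord pauli_y (bloch x y z) = y"
  "pauli_coord pauli_z (bloch x y z) = z"
  by (simp_all add: pauli_coord_def bloch_def pauli_vec_def matrix_2_simps field_simps)

lemma trace_bloch_pauli:
  "trace (bloch x y z ** pauli_x) = of_real x" "trace (bloch x y z ** pauli_y) = of_real y"
  "trace (bloch x y z ** pauli_z) = of_real z"
  by (simp_all add: bloch_def pauli_vec_def matrix_2_simps field_simps)

lemma pauli_coord_pauli:
  "pauli_coord pauli_x pauli_x = 2" "pauli_coord pauli_y pauli_y = 2"
  "pauli_coord pauli_y pauli_x = 0" "pauli_coord pauli_z pauli_x = 0"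
  "pauli_coord pauli_x pauli_y = 0" "pauli_coord pauli_z pauli_y = 0"
  by (simp_all add: pauli_coord_def matrix_2_simps)

lemma bounded_linear_pauli_coord: "bounded_linear (pauli_coord P)"
proof -
  have "linear (pauli_coord P)"
    by (rule linearI)
      (simp_all add: pauli_coord_def matrix_mult_add_rdistrib trace_add matrix_mult_scaleR trace_scaleR)
  then show ?thesis by (simp add: linear_conv_bounded_linear)
qed

section \<open>Logarithms of the sandwiched Choi matrices\<close>

text \<open>The coefficients m form the matrix of A on the plane. Cayley-Hamilton, with k1 and k2
  the roots of its characteristic polynomial, gives the quadratic relation that
  \<open>matrix_fun_mult_vec_interpolate\<close> requires.\<close>

lemma matrix_log_invariant_plane:
  fixes S B1 B2 :: "complex^2^2"
  assumes "hermitian A" and k: "0 < k1" "0 < k2"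
    and A1: "A *v vec_of (S ** B1) = vec_of (S ** (m11 *\<^sub>R B1 + m21 *\<^sub>R B2))"
    and A2: "A *v vec_of (S ** B2) = vec_of (S ** (m12 *\<^sub>R B1 + m22 *\<^sub>R B2))"
    and tr: "k1 + k2 = m11 + m22" and det: "k1 * k2 = m11 * m22 - m12 * m21"
    and log: "ln k1 = \<alpha> + \<beta> * k1" "ln k2 = \<alpha> + \<beta> * k2"
  shows "matrix_log A *v vec_of (S ** B1) = vec_of (S ** ((\<alpha> + \<beta> * m11) *\<^sub>R B1 + (\<beta> * m21) *\<^sub>R B2))"
    and "matrix_log A *v vec_of (S ** B2) = vec_of (S ** ((\<beta> * m12) *\<^sub>R B1 + (\<alpha> + \<beta> * m22) *\<^sub>R B2))"
proof -
  note simps = matrix_add_ldistrib matrix_mult_scaleR vec_of_add vec_of_scaleR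
    matrix_vector_right_distrib matrix_vector_mult_scaleR_right
  have log': "(if k1 > 0 then ln k1 else 0) = \<alpha> + \<beta> * k1" "(if k2 > 0 then ln k2 else 0) = \<alpha> + \<beta> * k2"
    using k log by simp_all
  let ?v1 = "vec_of (S ** B1)" and ?v2 = "vec_of (S ** B2)"
  have A1': "A *v ?v1 = m11 *\<^sub>R ?v1 + m21 *\<^sub>R ?v2" and A2': "A *v ?v2 = m12 *\<^sub>R ?v1 + m22 *\<^sub>R ?v2"
    by (simp_all only: A1 A2 simps)
  have "A *v (A *v ?v1) = (k1 + k2) *\<^sub>R (A *v ?v1) - (k1 * k2) *\<^sub>R ?v1"
    unfolding tr det A1' matrix_vector_right_distrib matrix_vector_mult_scaleR_right A2'
    by (simp add: algebra_simps)
  from matrix_fun_mult_vec_interpolate[OF assms(1) this log']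
  show "matrix_log A *v ?v1 = vec_of (S ** ((\<alpha> + \<beta> * m11) *\<^sub>R B1 + (\<beta> * m21) *\<^sub>R B2))"
    by (simp add: matrix_log_def A1' simps scaleR_add_left scaleR_add_right)
  have "A *v (A *v ?v2) = (k1 + k2) *\<^sub>R (A *v ?v2) - (k1 * k2) *\<^sub>R ?v2"
    unfolding tr det A2' matrix_vector_right_distrib matrix_vector_mult_scaleR_right A1'
    by (simp add: algebra_simps)
  from matrix_fun_mult_vec_interpolate[OF assms(1) this log']
  show "matrix_log A *v ?v2 = vec_of (S ** ((\<beta> * m12) *\<^sub>R B1 + (\<alpha> + \<beta> * m22) *\<^sub>R B2))"
    by (simp add: matrix_log_def A2' simps scaleR_add_left scaleR_add_right)
qed

text \<open>The plane of 1 and \<sigma>_z contains the range of this operator; trace and determinant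
  on it are 1 and q(1-q)(1-z^2). The coefficients \<open>\<alpha>\<close> and \<open>\<beta>\<close>
  stay abstract: they do not enter the transverse components of \<Omega> and combine to an entropy
  in f.\<close>

lemma matrix_log_sandwiched_dephasing:
  fixes x y z q :: real
  defines "\<rho> \<equiv> bloch x y z"
  defines "S \<equiv> matrix_power \<rho> (1/2)" and "L \<equiv> matrix_log (sandwiched_choi (dephasing q) \<rho>)"
  assumes "x\<^sup>2 + y\<^sup>2 + z\<^sup>2 < 1" and k: "0 < k1" "0 < k2" "k1 + k2 = 1" "k1 * k2 = q * (1 - q) * (1 - z\<^sup>2)"
    and log: "ln k1 = \<alpha> + \<beta> * k1" "ln k2 = \<alpha> + \<beta> * k2"
  shows "L *v vec_of S = vec_of (S ** ((\<alpha> + \<beta> * q) *\<^sub>R mat 1 + (\<beta> * ((1 - q) * z)) *\<^sub>R pauli_z))"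
    and "L *v vec_of (S ** pauli_z) = vec_of (S ** ((\<beta> * (q * z)) *\<^sub>R mat 1 + (\<alpha> + \<beta> * (1 - q)) *\<^sub>R pauli_z))"
proof -
  have pd: "positive_definite \<rho>"
    unfolding \<rho>_def by (rule positive_definite_bloch) fact
  have h: "hermitian (sandwiched_choi (dephasing q) \<rho>)"
    unfolding \<rho>_def by (intro hermitian_sandwiched_choi hermitian_bloch hermitian_choi_dephasing)
  let ?T = "\<lambda>B. q *\<^sub>R mat (trace (\<rho> ** B)) + (1 - q) *\<^sub>R (mat (trace (pauli_z ** \<rho> ** B)) ** pauli_z)"
  have B1: "?T (mat 1) = q *\<^sub>R mat 1 + ((1 - q) * z) *\<^sub>R pauli_z"
    and B2: "?T pauli_z = (q * z) *\<^sub>R mat 1 + (1 - q) *\<^sub>R pauli_z"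
    unfolding \<rho>_def by (simp_all add: bloch_def pauli_vec_def matrix_2_simps field_simps)
  have A1: "sandwiched_choi (dephasing q) \<rho> *v vec_of (S ** mat 1)
      = vec_of (S ** (q *\<^sub>R mat 1 + ((1 - q) * z) *\<^sub>R pauli_z))"
    unfolding S_def sandwiched_dephasing_mult_vec[OF pd] B1 ..
  have A2: "sandwiched_choi (dephasing q) \<rho> *v vec_of (S ** pauli_z)
      = vec_of (S ** ((q * z) *\<^sub>R mat 1 + (1 - q) *\<^sub>R pauli_z))"
    unfolding S_def sandwiched_dephasing_mult_vec[OF pd] B2 ..
  have det: "k1 * k2 = q * (1 - q) - q * z * ((1 - q) * z)"
    using k(4) by (simp add: power2_eq_square algebra_simps)
  show "L *v vec_of S = vec_of (S ** ((\<alpha> + \<beta> * q) *\<^sub>R mat 1 + (\<beta> * ((1 - q) * z)) *\<^sub>R pauli_z))"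
    using matrix_log_invariant_plane(1)[OF h k(1,2) A1 A2 _ det log] k(3) by (simp add: L_def)
  show "L *v vec_of (S ** pauli_z) = vec_of (S ** ((\<beta> * (q * z)) *\<^sub>R mat 1 + (\<alpha> + \<beta> * (1 - q)) *\<^sub>R pauli_z))"
    using matrix_log_invariant_plane(2)[OF h k(1,2) A1 A2 _ det log] k(3) by (simp add: L_def)
qed

text \<open>
  The depolarizing part has the eigenvalues \<open>(1 - p/2 \<plusminus> rad p s)/2\<close> on the plane of \<open>1\<close> and \<open>R\<close>, and
  \<open>(p/4)(1 \<plusminus> \<surd>s)\<close> on the plane of \<open>O\<close> and \<open>R O\<close>, where \<open>O\<close> is the part of \<open>\<sigma>\<^sub>z\<close> orthogonal to \<open>R\<close>. The
  slopes of \<open>ln\<close> between the eigenvalues are \<open>2 log_slope p s\<close> and \<open>(4/p) log_slope_off s\<close>, and the mean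
  values of \<open>ln\<close> are \<open>log_mean p s + log_offset p\<close> and \<open>log_mean p s\<close>. At \<open>s = 0\<close>, \<open>log_slope_off\<close> has the
  junk value \<open>0\<close> instead of \<open>1\<close>.
\<close>

definition rad :: "real \<Rightarrow> real \<Rightarrow> real" where
  "rad p s = sqrt ((1 - p)\<^sup>2 + p * (1 - 3 * p / 4) * s)"

definition log_slope :: "real \<Rightarrow> real \<Rightarrow> real" where
  "log_slope p s = (ln (1 - p/2 + rad p s) - ln (1 - p/2 - rad p s)) / (2 * rad p s)"

definition log_slope_off :: "real \<Rightarrow> real" where
  "log_slope_off s = (ln (1 + sqrt s) - ln (1 - sqrt s)) / (2 * sqrt s)"

definition log_mean :: "real \<Rightarrow> real \<Rightarrow> real" where
  "log_mean p s = ln (p/4) + ln (1 - s) / 2"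

definition log_offset :: "real \<Rightarrow> real" where
  "log_offset p = (ln (4 - 3 * p) - ln p) / 2"

lemma rad_square:
  assumes "0 < p" "p < 1" "0 \<le> s"
  shows "(rad p s)\<^sup>2 = (1 - p)\<^sup>2 + p * (1 - 3 * p / 4) * s"
  unfolding rad_def using assms
  by (intro real_sqrt_pow2 add_nonneg_nonneg mult_nonneg_nonneg) auto

lemma sq_gap: "(1 - p/2)\<^sup>2 - (1 - p)\<^sup>2 = p * (1 - 3 * p / 4)" for p :: real
  by (simp add: power2_eq_square field_simps)

lemma rad_bounds:
  assumes "0 < p" "p < 1" "0 \<le> s" "s < 1"
  shows "1 - p \<le> rad p s" "rad p s < 1 - p/2"
proof -
  have "0 \<le> p * (1 - 3 * p / 4) * s"
    using assms by (intro mult_nonneg_nonneg) auto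
  then have "(1 - p)\<^sup>2 \<le> (rad p s)\<^sup>2"
    using assms by (simp add: rad_square)
  then show "1 - p \<le> rad p s"
    by (rule power2_le_imp_le) (use \<open>0 \<le> p * (1 - 3 * p / 4) * s\<close> in \<open>simp add: rad_def\<close>)
  have "p * (1 - 3 * p / 4) * s < p * (1 - 3 * p / 4) * 1"
    using assms by (intro mult_strict_left_mono) auto
  then have "(rad p s)\<^sup>2 < (1 - p/2)\<^sup>2"
    using sq_gap[of p] unfolding rad_square[OF assms(1-3)] by linarith
  then show "rad p s < 1 - p/2"
    by (rule power2_less_imp_less) (use assms in simp)
qed

lemma matrix_log_sandwiched_depolarizing:
  fixes x y z p :: real
  defines "\<rho> \<equiv> bloch x y z" and "R \<equiv> pauli_vec x y z" and "s \<equiv> x\<^sup>2 + y\<^sup>2 + z\<^sup>2"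
  defines "S \<equiv> matrix_power \<rho> (1/2)" and "L \<equiv> matrix_log (sandwiched_choi (depolarizing p) \<rho>)"
  assumes p: "0 < p" "p < 1" and s: "0 < s" "s < 1"
  shows "L *v vec_of S = vec_of (S **
      ((log_mean p s + log_offset p + (1 - p) * log_slope p s) *\<^sub>R mat 1 + (p/2 * log_slope p s) *\<^sub>R R))"
    and "L *v vec_of (S ** pauli_z) = vec_of (S **
      ((((2 - 3/2 * p) * log_slope p s - log_slope_off s) * z) *\<^sub>R mat 1
       + ((log_offset p - (1 - p) * log_slope p s) * z / s) *\<^sub>R R
       + log_mean p s *\<^sub>R pauli_z + log_slope_off s *\<^sub>R (R ** pauli_z)))"
proof -
  let ?A = "sandwiched_choi (depolarizing p) \<rho>"
  let ?T = "\<lambda>B. (1 - p) *\<^sub>R mat (trace (\<rho> ** B)) + (p/2) *\<^sub>R (\<rho> ** B)"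
  \<comment> \<open>The part of \<sigma>_z orthogonal to R. Since \<open>trace (\<rho> ** B)\<close>
    vanishes for B in the plane of \<open>?O\<close> and \<open>R ** ?O\<close>, there
    \<open>?T\<close> is p/2 times left multiplication by \<rho>.\<close>
  let ?O = "pauli_z - (z/s) *\<^sub>R R"
  let ?w = "log_slope p s" and ?y = "log_slope_off s" and ?m = "log_mean p s" and ?k = "log_offset p"
  have pd: "positive_definite \<rho>"
    unfolding \<rho>_def using s by (intro positive_definite_bloch) (simp add: s_def)
  have h: "hermitian ?A"
    unfolding \<rho>_def by (intro hermitian_sandwiched_choi hermitian_bloch hermitian_choi_depolarizing)
  have \<rho>: "\<rho> = (1/2) *\<^sub>R (mat 1 + R)" by (simp add: \<rho>_def R_def bloch_def)
  have RR: "R ** R = s *\<^sub>R mat 1" by (simp add: R_def s_def pauli_vec_square)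
  have RO: "R ** ?O = R ** pauli_z - z *\<^sub>R mat 1"
    using s by (simp add: matrix_mult_diff_ldistrib matrix_mult_scaleR RR)
  have RRO: "R ** (R ** ?O) = s *\<^sub>R ?O"
    by (simp add: matrix_mul_assoc RR matrix_mult_scaleR)
  have tr: "trace R = 0" "trace (R ** pauli_z) = of_real (2 * z)" "trace pauli_z = 0"
    "trace (mat 1 :: complex^2^2) = 2"
    by (simp_all add: R_def pauli_vec_def matrix_2_simps)
  note dist = \<rho> matrix_mult_scaleR matrix_mult_add_rdistrib RR trace_scaleR trace_add trace_sub tr
  have mat_real: "mat (of_real c) = c *\<^sub>R (mat 1 :: complex^2^2)" for c
    by (simp add: matrix_2_simps)
  have "trace (\<rho> ** mat 1) = of_real 1" "trace (\<rho> ** R) = of_real s" "trace (\<rho> ** ?O) = of_real 0"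
    using s by (simp_all add: dist RO)
  moreover have "trace (\<rho> ** (R ** ?O)) = of_real 0"
    using s by (simp add: dist RRO) (simp add: RO dist trace_sub)
  ultimately have tr\<rho>: "mat (trace (\<rho> ** mat 1)) = 1 *\<^sub>R (mat 1 :: complex^2^2)"
    "mat (trace (\<rho> ** R)) = s *\<^sub>R (mat 1 :: complex^2^2)"
    "mat (trace (\<rho> ** ?O)) = 0 *\<^sub>R (mat 1 :: complex^2^2)"
    "mat (trace (\<rho> ** (R ** ?O))) = 0 *\<^sub>R (mat 1 :: complex^2^2)"
    by (simp_all only: mat_real)
  have T1: "?T (mat 1) = (1 - p + p/4) *\<^sub>R mat 1 + (p/4) *\<^sub>R R"
    unfolding tr\<rho> by (simp add: \<rho> vec_eq_iff complex_eq_iff algebra_simps)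
  have T2: "?T R = ((1 - p + p/4) * s) *\<^sub>R mat 1 + (p/4) *\<^sub>R R"
    unfolding tr\<rho> by (simp add: dist) (simp add: vec_eq_iff complex_eq_iff algebra_simps)
  have T3: "?T ?O = (p/4) *\<^sub>R ?O + (p/4) *\<^sub>R (R ** ?O)"
    unfolding tr\<rho> by (simp add: dist scaleR_add_right)
  have T4: "?T (R ** ?O) = (p/4 * s) *\<^sub>R ?O + (p/4) *\<^sub>R (R ** ?O)"
    unfolding tr\<rho> by (simp add: dist RRO scaleR_add_right)
  note A = sandwiched_depolarizing_mult_vec[OF pd, of p, folded S_def]
  define r where "r = rad p s"
  have r: "0 < r" "r < 1 - p/2"
    using rad_bounds[of p s] p s by (simp_all add: r_def)
  have rr: "(1 - p/2 + r) / 2 * ((1 - p/2 - r) / 2) = p/4 * ((4 - 3 * p)/4) * (1 - s)"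
  proof -
    have "(1 - p/2 + r) / 2 * ((1 - p/2 - r) / 2) = ((1 - p/2)\<^sup>2 - r\<^sup>2) / 4"
      by (simp add: power2_eq_square field_simps)
    also have "r\<^sup>2 = (1 - p/2)\<^sup>2 - p * (1 - 3 * p / 4) + p * (1 - 3 * p / 4) * s"
      using rad_square[of p s] p s sq_gap[of p] by (simp add: r_def)
    finally show ?thesis by (simp add: field_simps)
  qed
  \<comment> \<open>Each logarithm is recovered from a sum and a difference: the determinant fixes
    the sum, and \<open>log_slope\<close> encodes the difference.\<close>
  have "ln ((1 - p/2 + r) / 2) + ln ((1 - p/2 - r) / 2) = ln (p/4 * ((4 - 3 * p)/4) * (1 - s))"
    using r p unfolding rr[symmetric] by (intro ln_mult_pos[symmetric]) auto
  also have "\<dots> = 2 * ?m + 2 * ?k"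
  proof -
    have "ln (p/4 * ((4 - 3 * p)/4) * (1 - s)) = ln (p/4) + ln ((4 - 3 * p)/4) + ln (1 - s)"
      using p s by (simp only: ln_mult_pos mult_pos_pos divide_pos_pos)
    then show ?thesis
      using p by (simp add: log_mean_def log_offset_def ln_div field_simps)
  qed
  finally have sum: "ln ((1 - p/2 + r) / 2) + ln ((1 - p/2 - r) / 2) = 2 * ?m + 2 * ?k" .
  have diff: "ln ((1 - p/2 + r) / 2) - ln ((1 - p/2 - r) / 2) = 2 * r * ?w"
    using r p by (simp add: log_slope_def r_def[symmetric] ln_div)
  have log1: "ln ((1 - p/2 + r) / 2) = (?m + ?k - (1 - p/2) * ?w) + (2 * ?w) * ((1 - p/2 + r) / 2)"
    "ln ((1 - p/2 - r) / 2) = (?m + ?k - (1 - p/2) * ?w) + (2 * ?w) * ((1 - p/2 - r) / 2)"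
  proof -
    have "(?m + ?k - (1 - p/2) * ?w) + (2 * ?w) * ((1 - p/2 + r) / 2) = ?m + ?k + r * ?w"
      "(?m + ?k - (1 - p/2) * ?w) + (2 * ?w) * ((1 - p/2 - r) / 2) = ?m + ?k - r * ?w"
      by (simp_all add: field_simps)
    with sum diff show "ln ((1 - p/2 + r) / 2) = (?m + ?k - (1 - p/2) * ?w) + (2 * ?w) * ((1 - p/2 + r) / 2)"
      "ln ((1 - p/2 - r) / 2) = (?m + ?k - (1 - p/2) * ?w) + (2 * ?w) * ((1 - p/2 - r) / 2)"
      by (simp_all only:)
  qed
  have det1: "(1 - p/2 + r) / 2 * ((1 - p/2 - r) / 2)
      = (1 - p + p/4) * (p/4) - (1 - p + p/4) * s * (p/4)"
    unfolding rr by (simp add: field_simps)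
  have tr1: "(1 - p/2 + r) / 2 + (1 - p/2 - r) / 2 = (1 - p + p/4) + p/4"
    by (simp add: field_simps)
  note plane1 = matrix_log_invariant_plane[OF h _ _ A[of "mat 1", unfolded T1] A[of R, unfolded T2] tr1 det1 log1]
  have pos1: "0 < (1 - p/2 + r) / 2" "0 < (1 - p/2 - r) / 2" using r p by simp_all
  define t where "t = sqrt s"
  have t: "0 < t" "t < 1" "t * t = s" using s by (auto simp: t_def)
  have pos2: "0 < p/4 * (1 + t)" "0 < p/4 * (1 - t)" using p t by simp_all
  have "ln (p/4 * (1 + t)) + ln (p/4 * (1 - t)) = ln (p/4 * (1 + t) * (p/4 * (1 - t)))"
    using p t by (intro ln_mult_pos[symmetric]) auto
  also have "p/4 * (1 + t) * (p/4 * (1 - t)) = (p/4)\<^sup>2 * (1 - s)"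
    by (simp add: t(3)[symmetric] power2_eq_square algebra_simps)
  also have "ln \<dots> = 2 * ?m"
    using p s by (simp add: log_mean_def ln_mult ln_realpow)
  finally have sum2: "ln (p/4 * (1 + t)) + ln (p/4 * (1 - t)) = 2 * ?m" .
  have diff2: "ln (p/4 * (1 + t)) - ln (p/4 * (1 - t)) = 2 * t * ?y"
  proof -
    have "ln (p/4 * (1 + t)) = ln (p/4) + ln (1 + t)" "ln (p/4 * (1 - t)) = ln (p/4) + ln (1 - t)"
      by (rule ln_mult_pos; use p t in simp)+
    then show ?thesis
      using t by (simp add: log_slope_off_def t_def[symmetric])
  qed
  have log2: "ln (p/4 * (1 + t)) = (?m - ?y) + (4 * ?y / p) * (p/4 * (1 + t))"
    "ln (p/4 * (1 - t)) = (?m - ?y) + (4 * ?y / p) * (p/4 * (1 - t))"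
  proof -
    have "(?m - ?y) + (4 * ?y / p) * (p/4 * (1 + t)) = ?m + t * ?y"
      "(?m - ?y) + (4 * ?y / p) * (p/4 * (1 - t)) = ?m - t * ?y"
      using p by (simp_all add: field_simps)
    with sum2 diff2 show "ln (p/4 * (1 + t)) = (?m - ?y) + (4 * ?y / p) * (p/4 * (1 + t))"
      "ln (p/4 * (1 - t)) = (?m - ?y) + (4 * ?y / p) * (p/4 * (1 - t))"
      by (simp_all only:)
  qed
  have det2: "p/4 * (1 + t) * (p/4 * (1 - t)) = p/4 * (p/4) - p/4 * s * (p/4)"
    by (simp add: t(3)[symmetric] field_simps)
  have tr2: "p/4 * (1 + t) + p/4 * (1 - t) = p/4 + p/4"
    by (simp add: field_simps)
  note plane2 = matrix_log_invariant_plane[OF h _ _ A[of ?O, unfolded T3] A[of "R ** ?O", unfolded T4] tr2 det2 log2]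
  show "L *v vec_of S = vec_of (S ** ((?m + ?k + (1 - p) * ?w) *\<^sub>R mat 1 + (p/2 * ?w) *\<^sub>R R))"
  proof -
    have c: "?m + ?k - (1 - p/2) * ?w + 2 * ?w * (1 - p + p/4) = ?m + ?k + (1 - p) * ?w"
      "2 * ?w * (p/4) = p/2 * ?w"
      by (simp_all add: field_simps)
    show ?thesis
      using plane1(1)[OF pos1] unfolding L_def c matrix_mul_rid .
  qed
  \<comment> \<open>\<sigma>_z = (z/s) R + O splits the vector between the two invariant
    planes.\<close>
  have "L *v vec_of (S ** pauli_z) = (z/s) *\<^sub>R (L *v vec_of (S ** R)) + L *v vec_of (S ** ?O)"
    by (simp add: matrix_mult_diff_ldistrib matrix_mult_scaleR vec_of_diff vec_of_scaleR
        matrix_vector_mult_diff_distrib matrix_vector_mult_scaleR_right)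
  also have "\<dots> = vec_of (S ** ((z/s) *\<^sub>R ((2 * ?w * ((1 - p + p/4) * s)) *\<^sub>R mat 1
       + (?m + ?k - (1 - p/2) * ?w + 2 * ?w * (p/4)) *\<^sub>R R)
      + (((?m - ?y) + 4 * ?y / p * (p/4)) *\<^sub>R ?O + (4 * ?y / p * (p/4)) *\<^sub>R (R ** ?O))))"
    using plane1(2)[OF pos1] plane2(1)[OF pos2]
    by (simp only: L_def matrix_add_ldistrib[of S] matrix_mult_scaleR(2)[of S] vec_of_add vec_of_scaleR)
  also have "(z/s) *\<^sub>R ((2 * ?w * ((1 - p + p/4) * s)) *\<^sub>R mat 1
       + (?m + ?k - (1 - p/2) * ?w + 2 * ?w * (p/4)) *\<^sub>R R)
      + (((?m - ?y) + 4 * ?y / p * (p/4)) *\<^sub>R ?O + (4 * ?y / p * (p/4)) *\<^sub>R (R ** ?O))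
     = (((2 - 3/2 * p) * ?w - ?y) * z) *\<^sub>R mat 1 + ((?k - (1 - p) * ?w) * z / s) *\<^sub>R R
       + ?m *\<^sub>R pauli_z + ?y *\<^sub>R (R ** pauli_z)"
    using s p unfolding RO by (simp add: vec_eq_iff complex_eq_iff field_simps)
  finally show "L *v vec_of (S ** pauli_z) = vec_of (S **
      ((((2 - 3/2 * p) * ?w - ?y) * z) *\<^sub>R mat 1 + ((?k - (1 - p) * ?w) * z / s) *\<^sub>R R
       + ?m *\<^sub>R pauli_z + ?y *\<^sub>R (R ** pauli_z)))" .
qed

text \<open>Evaluates the traces of \<open>trace_Omega1_dephasing\<close> for logarithms of the form
  found above. Tr(R \<sigma>_x \<sigma>_z) is purely imaginary, so against \<sigma>_x only the
  coefficient of R survives, and against \<sigma>_x \<sigma>_z only that of R \<sigma>_z; likewise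
  for \<sigma>_y.\<close>

lemma trace_pauli_combinations:
  fixes x y z :: real
  defines "\<rho> \<equiv> bloch x y z" and "R \<equiv> pauli_vec x y z"
  shows "Re (trace (dagger (a *\<^sub>R mat 1 + b *\<^sub>R R + c *\<^sub>R pauli_z) ** \<rho>)) = a + b * (x\<^sup>2 + y\<^sup>2 + z\<^sup>2) + c * z"
    and "Re (trace (dagger (a *\<^sub>R mat 1 + b *\<^sub>R R + c *\<^sub>R pauli_z) ** pauli_x)) = 2 * b * x"
    and "Re (trace (dagger (a *\<^sub>R mat 1 + b *\<^sub>R R + c *\<^sub>R pauli_z) ** pauli_y)) = 2 * b * y"
    and "Re (trace (dagger (a *\<^sub>R mat 1 + b *\<^sub>R R + c *\<^sub>R pauli_z + d *\<^sub>R (R ** pauli_z)) ** (\<rho> ** pauli_z)))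
      = (a + b) * z + c + d * (x\<^sup>2 + y\<^sup>2 + z\<^sup>2)"
    and "Re (trace (dagger (a *\<^sub>R mat 1 + b *\<^sub>R R + c *\<^sub>R pauli_z + d *\<^sub>R (R ** pauli_z)) ** (pauli_x ** pauli_z)))
      = 2 * d * x"
    and "Re (trace (dagger (a *\<^sub>R mat 1 + b *\<^sub>R R + c *\<^sub>R pauli_z + d *\<^sub>R (R ** pauli_z)) ** (pauli_y ** pauli_z)))
      = 2 * d * y"
proof -
  have dag: "dagger R = R" "dagger pauli_z = pauli_z"
    using hermitian_pauli_vec hermitian_pauli by (simp_all add: R_def hermitianD)
  have dag_scaleR: "dagger (t *\<^sub>R A) = t *\<^sub>R dagger A" for t and A :: "complex^2^2"
    by (simp add: dagger_def vec_eq_iff)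
  note expand = dagger_add dag_scaleR dagger_mult dag dagger_mat_1 matrix_mult_add_rdistrib
    matrix_mult_scaleR trace_add trace_scaleR matrix_mul_lid
  note calc = bloch_def pauli_vec_def matrix_2_simps
  have \<rho>: "\<rho> = (1/2) *\<^sub>R (mat 1 + R)" by (simp add: \<rho>_def R_def bloch_def)
  have RR: "R ** R = (x\<^sup>2 + y\<^sup>2 + z\<^sup>2) *\<^sub>R mat 1" by (simp add: R_def pauli_vec_square)
  have trR: "trace R = 0" "trace (mat 1 :: complex^2^2) = 2" "Re (trace (R ** pauli_z)) = 2 * z"
    "trace pauli_z = 0" "Re (trace (pauli_z ** R)) = 2 * z"
    by (simp_all add: R_def calc)
  have zz: "pauli_z ** pauli_z = mat 1" by (simp add: matrix_2_simps)
  have cyc: "trace (pauli_z ** (A ** pauli_z)) = trace A" for A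
    using trace_mul_sym[of pauli_z "A ** pauli_z"] by (simp add: matrix_mul_assoc[symmetric] zz)
  have R\<rho>: "R ** \<rho> = (1/2) *\<^sub>R (R + (x\<^sup>2 + y\<^sup>2 + z\<^sup>2) *\<^sub>R mat 1)"
    by (simp add: \<rho> matrix_add_ldistrib matrix_mult_scaleR RR)
  have tr_Rz: "Re (trace (R ** \<rho> ** pauli_z)) = z"
    unfolding R\<rho> by (simp add: expand trR)
  have "Re (trace \<rho>) = 1" "Re (trace (R ** \<rho>)) = x\<^sup>2 + y\<^sup>2 + z\<^sup>2" "Re (trace (pauli_z ** \<rho>)) = z"
    "Re (trace (\<rho> ** pauli_z)) = z"
    unfolding R\<rho> by (simp_all add: \<rho> matrix_add_ldistrib expand trR)
  note base = this
  show "Re (trace (dagger (a *\<^sub>R mat 1 + b *\<^sub>R R + c *\<^sub>R pauli_z) ** \<rho>)) = a + b * (x\<^sup>2 + y\<^sup>2 + z\<^sup>2) + c * z"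
    by (simp add: expand base)
  have X: "trace pauli_x = 0" "Re (trace (R ** pauli_x)) = 2 * x" "trace (pauli_z ** pauli_x) = 0"
    "trace (pauli_x ** pauli_z) = 0" "Re (trace (R ** (pauli_x ** pauli_z))) = 0"
    by (simp_all add: R_def calc)
  have Y: "trace pauli_y = 0" "Re (trace (R ** pauli_y)) = 2 * y" "trace (pauli_z ** pauli_y) = 0"
    "trace (pauli_y ** pauli_z) = 0" "Re (trace (R ** (pauli_y ** pauli_z))) = 0"
    by (simp_all add: R_def calc)
  show "Re (trace (dagger (a *\<^sub>R mat 1 + b *\<^sub>R R + c *\<^sub>R pauli_z) ** pauli_x)) = 2 * b * x"
    "Re (trace (dagger (a *\<^sub>R mat 1 + b *\<^sub>R R + c *\<^sub>R pauli_z) ** pauli_y)) = 2 * b * y"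
    by (simp_all add: expand X Y)
  have assoc: "pauli_z ** R ** (A ** pauli_z) = pauli_z ** ((R ** A) ** pauli_z)" for A
    by (simp add: matrix_mul_assoc)
  show "Re (trace (dagger (a *\<^sub>R mat 1 + b *\<^sub>R R + c *\<^sub>R pauli_z + d *\<^sub>R (R ** pauli_z)) ** (\<rho> ** pauli_z)))
      = (a + b) * z + c + d * (x\<^sup>2 + y\<^sup>2 + z\<^sup>2)"
    using tr_Rz by (simp add: expand assoc cyc base matrix_mul_assoc[of R \<rho>] algebra_simps)
  show "Re (trace (dagger (a *\<^sub>R mat 1 + b *\<^sub>R R + c *\<^sub>R pauli_z + d *\<^sub>R (R ** pauli_z)) ** (pauli_x ** pauli_z)))
      = 2 * d * x"
    "Re (trace (dagger (a *\<^sub>R mat 1 + b *\<^sub>R R + c *\<^sub>R pauli_z + d *\<^sub>R (R ** pauli_z)) ** (pauli_y ** pauli_z)))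
      = 2 * d * y"
    by (simp_all add: expand assoc cyc X Y)
qed

section \<open>Closed forms of f and of the transverse components of Omega1\<close>

lemma affine_interpolation:
  fixes a b u v :: real
  assumes "a = b \<Longrightarrow> u = v"
  obtains \<alpha> \<beta> where "u = \<alpha> + \<beta> * a" "v = \<alpha> + \<beta> * b"
proof (cases "a = b")
  case True
  show thesis by (rule that[of u 0]) (simp_all add: assms True)
next
  case False
  define \<beta> where "\<beta> = (u - v) / (a - b)"
  have \<beta>: "\<beta> * (a - b) = u - v" using False by (simp add: \<beta>_def)
  show thesis
    by (rule that[of "u - \<beta> * a" \<beta>]) (use \<beta> in \<open>simp_all add: algebra_simps\<close>)
qed

text \<open>The entropy of the eigenvalues (1 + m)/2 and (1 - m)/2 of the sandwiched dephasing
  operator on its invariant plane.\<close>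

definition dephasing_entropy :: "real \<Rightarrow> real \<Rightarrow> real" where
  "dephasing_entropy q z = (let m = sqrt (1 - 4 * q * (1 - q) * (1 - z\<^sup>2)) in
     - ((1 + m)/2 * ln ((1 + m)/2) + (1 - m)/2 * ln ((1 - m)/2)))"

text \<open>The contribution of the depolarizing logarithm to f that depends on s alone;
  \<open>axial_part\<close> is the coefficient of (1 - q) z^2 in the rest.\<close>

definition isotropic_part :: "real \<Rightarrow> real \<Rightarrow> real \<Rightarrow> real" where
  "isotropic_part p q s = q * (log_mean p s + log_offset p + (1 - p + p/2 * s) * log_slope p s)
     + (1 - q) * (log_mean p s + log_slope_off s * s)"

definition axial_part :: "real \<Rightarrow> real \<Rightarrow> real" where
  "axial_part p s = (log_offset p - (1 - p) * log_slope p s) / s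
     + (2 - 3/2 * p) * log_slope p s - log_slope_off s"

text \<open>These are the eigenvalues of the Gram matrix of sqrt(q) vec(S) and sqrt(1-q) vec(S
  \<sigma>_z), where S is the square root of \<rho>.\<close>

lemma dephasing_gram_eigenvalues:
  assumes "0 < q" "q < 1" "z\<^sup>2 < 1" and "m = sqrt (1 - 4 * q * (1 - q) * (1 - z\<^sup>2))"
  shows "0 \<le> m" "m < 1" "(1 + m)/2 * ((1 - m)/2) = q * (1 - q) * (1 - z\<^sup>2)"
proof -
  have "4 * q * (1 - q) = 1 - (1 - 2 * q)\<^sup>2" by (simp add: power2_eq_square algebra_simps)
  moreover have "0 \<le> (1 - 2 * q)\<^sup>2" by simp
  ultimately have le: "4 * q * (1 - q) \<le> 1" by linarith
  have pos: "0 < 4 * q * (1 - q) * (1 - z\<^sup>2)"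
    using assms by simp
  have "4 * q * (1 - q) * (1 - z\<^sup>2) \<le> 4 * q * (1 - q) * 1"
    using assms by (intro mult_left_mono) auto
  then have nonneg: "0 \<le> 1 - 4 * q * (1 - q) * (1 - z\<^sup>2)" using le by linarith
  then show "0 \<le> m" "m < 1" using pos by (simp_all add: assms(4))
  have "m\<^sup>2 = 1 - 4 * q * (1 - q) * (1 - z\<^sup>2)"
    using nonneg by (simp add: assms(4))
  then show "(1 + m)/2 * ((1 - m)/2) = q * (1 - q) * (1 - z\<^sup>2)"
    by (simp add: power2_eq_square field_simps)
qed

lemma bloch_sq_bound: "x\<^sup>2 + y\<^sup>2 + z\<^sup>2 < 1 \<Longrightarrow> z\<^sup>2 < 1" for x y z :: real
  using zero_le_power2[of x] zero_le_power2[of y] by linarith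

text \<open>Both logarithms are inserted into \<open>trace_Omega1_dephasing\<close>. The dephasing
  one only adds multiples of 1 and \<sigma>_z, hence does not reach the \<sigma>_x and \<sigma>_y
  components.\<close>

lemma Omega1_dephasing_depolarizing:
  fixes x y z p q :: real
  defines "\<rho> \<equiv> bloch x y z" and "s \<equiv> x\<^sup>2 + y\<^sup>2 + z\<^sup>2"
  assumes p: "0 < p" "p < 1" and q: "0 < q" "q < 1" and s: "0 < s" "s < 1"
  shows "neg_relative_entropy (dephasing q) (depolarizing p) \<rho>
      = dephasing_entropy q z + isotropic_part p q s + (1 - q) * (z\<^sup>2 * axial_part p s)"
    and "Re (trace (Omega1 (dephasing q) (depolarizing p) \<rho> ** pauli_x))
      = 2 * x * (q * (p/2 * log_slope p s) + (1 - q) * log_slope_off s)"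
    and "Re (trace (Omega1 (dephasing q) (depolarizing p) \<rho> ** pauli_y))
      = 2 * y * (q * (p/2 * log_slope p s) + (1 - q) * log_slope_off s)"
proof -
  let ?w = "log_slope p s" and ?y = "log_slope_off s" and ?m = "log_mean p s" and ?k = "log_offset p"
  let ?R = "pauli_vec x y z" and ?\<Omega> = "Omega1 (dephasing q) (depolarizing p) \<rho>"
  define m where "m = sqrt (1 - 4 * q * (1 - q) * (1 - z\<^sup>2))"
  define k1 where "k1 = (1 + m)/2"
  define k2 where "k2 = (1 - m)/2"
  have z: "z\<^sup>2 < 1" using s bloch_sq_bound by (simp add: s_def)
  note m = dephasing_gram_eigenvalues[OF q z m_def]
  have k: "0 < k1" "0 < k2" "k1 + k2 = 1" "k1 * k2 = q * (1 - q) * (1 - z\<^sup>2)"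
    using m by (simp_all add: k1_def k2_def field_simps)
  \<comment> \<open>Interpolation instead of a difference quotient, because k1 = k2 occurs at q =
    1/2, z = 0.\<close>
  obtain \<alpha> \<beta> where log: "ln k1 = \<alpha> + \<beta> * k1" "ln k2 = \<alpha> + \<beta> * k2"
    using affine_interpolation[of k1 k2 "ln k1" "ln k2"] by auto
  define S where "S = matrix_power \<rho> (1/2)"
  define L where "L = matrix_log (sandwiched_choi (dephasing q) \<rho>)
    - matrix_log (sandwiched_choi (depolarizing p) \<rho>)"
  have pd: "positive_definite \<rho>"
    unfolding \<rho>_def using s by (intro positive_definite_bloch) (simp add: s_def)
  let ?a1 = "\<alpha> + \<beta> * q - (?m + ?k + (1 - p) * ?w)" and ?b1 = "- (p/2 * ?w)" and ?c1 = "\<beta> * ((1 - q) * z)"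
  let ?a2 = "\<beta> * (q * z) - ((2 - 3/2 * p) * ?w - ?y) * z" and ?b2 = "- ((?k - (1 - p) * ?w) * z / s)"
    and ?c2 = "\<alpha> + \<beta> * (1 - q) - ?m" and ?d2 = "- ?y"
  let ?Z1 = "?a1 *\<^sub>R mat 1 + ?b1 *\<^sub>R ?R + ?c1 *\<^sub>R pauli_z"
  let ?Z2 = "?a2 *\<^sub>R mat 1 + ?b2 *\<^sub>R ?R + ?c2 *\<^sub>R pauli_z + ?d2 *\<^sub>R (?R ** pauli_z)"
  note s' = s[unfolded s_def]
  note deph = matrix_log_sandwiched_dephasing[OF s'(2) k log]
  note depo = matrix_log_sandwiched_depolarizing[OF p s']
  have Z1: "L *v vec_of S = vec_of (S ** ?Z1)"
    unfolding L_def S_def \<rho>_def s_def matrix_vector_mult_diff_rdistrib deph(1) depo(1)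
    by (simp add: vec_of_diff[symmetric] matrix_mult_diff_ldistrib[symmetric] scaleR_diff_left algebra_simps)
  have Z2: "L *v vec_of (S ** pauli_z) = vec_of (S ** ?Z2)"
    unfolding L_def S_def \<rho>_def s_def matrix_vector_mult_diff_rdistrib deph(2) depo(2)
    by (simp add: vec_of_diff[symmetric] matrix_mult_diff_ldistrib[symmetric] scaleR_diff_left algebra_simps)
  have tr: "Re (trace (?\<Omega> ** X)) = - (q * Re (trace (dagger ?Z1 ** X))
      + (1 - q) * Re (trace (dagger ?Z2 ** (X ** pauli_z))))" for X
    by (simp add: trace_Omega1_dephasing[OF pd hermitian_choi_depolarizing S_def L_def Z1 Z2])
  note combo = trace_pauli_combinations[of _ _ x y z, folded \<rho>_def]
  show "Re (trace (?\<Omega> ** pauli_x)) = 2 * x * (q * (p/2 * ?w) + (1 - q) * ?y)"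
    unfolding tr combo by (simp add: algebra_simps)
  show "Re (trace (?\<Omega> ** pauli_y)) = 2 * y * (q * (p/2 * ?w) + (1 - q) * ?y)"
    unfolding tr combo by (simp add: algebra_simps)
  \<comment> \<open>Writing k1^2 + k2^2 through sum and product makes \<open>\<alpha>\<close> and
    \<open>\<beta>\<close> appear in the entropy exactly as in the trace formula for f.\<close>
  have "k1 * ln k1 + k2 * ln k2 = \<alpha> * (k1 + k2) + \<beta> * ((k1 + k2)\<^sup>2 - 2 * (k1 * k2))"
    unfolding log by (simp add: power2_eq_square algebra_simps)
  moreover have "dephasing_entropy q z = - (k1 * ln k1 + k2 * ln k2)"
    by (simp add: dephasing_entropy_def m_def k1_def k2_def Let_def)
  ultimately have ent: "dephasing_entropy q z = - (\<alpha> + \<beta> * (1 - 2 * (q * (1 - q) * (1 - z\<^sup>2))))"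
    by (simp add: k(3,4))
  have "neg_relative_entropy (dephasing q) (depolarizing p) \<rho>
      = - (q * (?a1 + ?b1 * s + ?c1 * z) + (1 - q) * ((?a2 + ?b2) * z + ?c2 + ?d2 * s))"
    unfolding neg_relative_entropy_eq_trace_Omega(2)[OF pd] tr combo s_def[symmetric] ..
  also have "\<dots> = dephasing_entropy q z + isotropic_part p q s + (1 - q) * (z\<^sup>2 * axial_part p s)"
  proof -
    define u where "u = (?k - (1 - p) * ?w) / s"
    have "?b2 = - (u * z)" "axial_part p s = u + (2 - 3/2 * p) * ?w - ?y"
      by (simp_all add: u_def axial_part_def)
    then show ?thesis
      by (simp only: ent isotropic_part_def) (simp add: power2_eq_square algebra_simps)
  qed
  finally show "neg_relative_entropy (dephasing q) (depolarizing p) \<rho>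
      = dephasing_entropy q z + isotropic_part p q s + (1 - q) * (z\<^sup>2 * axial_part p s)" .
qed

section \<open>Derivatives in the squared Bloch radius\<close>

lemma rad_pos: "0 < p \<Longrightarrow> p < 1 \<Longrightarrow> 0 \<le> s \<Longrightarrow> s < 1 \<Longrightarrow> 0 < rad p s"
  using rad_bounds(1)[of p s] by linarith

lemma rad_gap:
  assumes "0 < p" "p < 1" "0 \<le> s"
  shows "(1 - p/2 + rad p s) * (1 - p/2 - rad p s) = p * (1 - 3 * p / 4) * (1 - s)"
proof -
  have "(1 - p/2 + rad p s) * (1 - p/2 - rad p s) = (1 - p/2)\<^sup>2 - (rad p s)\<^sup>2"
    by (simp add: power2_eq_square algebra_simps)
  also have "\<dots> = p * (1 - 3 * p / 4) - p * (1 - 3 * p / 4) * s"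
    using sq_gap[of p] unfolding rad_square[OF assms] by linarith
  finally show ?thesis by (simp add: right_diff_distrib)
qed

lemma DERIV_rad:
  assumes "0 < p" "p < 1" "0 \<le> s" "s < 1"
  shows "(rad p has_real_derivative p * (1 - 3 * p / 4) / (2 * rad p s)) (at s)"
proof -
  have "0 < (1 - p)\<^sup>2 + p * (1 - 3 * p / 4) * s"
    using rad_pos[OF assms] by (simp add: rad_def)
  then show ?thesis
    unfolding rad_def[abs_def]
    by (auto intro!: derivative_eq_intros simp: field_simps)
qed

text \<open>Common template for the two slopes: \<open>f\<close> is \<open>rad p\<close> with
  \<open>a = 1 - p/2\<close>, or \<open>sqrt\<close> with \<open>a = 1\<close>.\<close>

lemma DERIV_log_ratio:
  fixes f :: "real \<Rightarrow> real"
  assumes f: "(f has_real_derivative d) (at s)" and r: "0 < f s" "f s < a"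
  shows "((\<lambda>s. (ln (a + f s) - ln (a - f s)) / (2 * f s)) has_real_derivative
    d * (a / ((a + f s) * (a - f s)) - (ln (a + f s) - ln (a - f s)) / (2 * f s)) / f s) (at s)"
proof -
  define N where "N = ln (a + f s) - ln (a - f s)"
  define u where "u = a + f s"
  define v where "v = a - f s"
  have uv: "0 < u" "0 < v" using r by (simp_all add: u_def v_def)
  have "((\<lambda>s. (ln (a + f s) - ln (a - f s)) / (2 * f s)) has_real_derivative
      ((d / u + d / v) * (2 * f s) - N * (2 * d)) / (2 * f s * (2 * f s))) (at s)"
    using r by (auto intro!: derivative_eq_intros f simp: u_def v_def N_def)
  also have "d / u + d / v = d * (2 * a) / (u * v)"
  proof -
    have "d / u + d / v = d * (u + v) / (u * v)" using uv by (simp add: field_simps)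
    then show ?thesis by (simp add: u_def v_def)
  qed
  also have "(d * (2 * a) / (u * v) * (2 * f s) - N * (2 * d)) / (2 * f s * (2 * f s))
      = d * (a / (u * v) - N / (2 * f s)) / f s"
    using uv r(1) by (simp add: field_simps)
  finally show ?thesis by (simp add: u_def v_def N_def)
qed

text \<open>By \<open>rad_gap\<close> the product (a + r)(a - r) is a multiple of 1 - s, so apart
  from \<open>log_slope\<close> itself the radius enters only through its square, which is affine in
  s.\<close>

lemma DERIV_log_slope:
  assumes "0 < p" "p < 1" "0 \<le> s" "s < 1"
  shows "(log_slope p has_real_derivative
    ((1 - p/2) / (1 - s) - p * (1 - 3 * p / 4) * log_slope p s) / (2 * (rad p s)\<^sup>2)) (at s)"
proof -
  define a where "a = 1 - p/2"
  define c where "c = p * (1 - 3 * p / 4)"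
  define r where "r = rad p s"
  have r: "0 < r" "r < a"
    using rad_pos[OF assms] rad_bounds(2)[OF assms] by (simp_all add: r_def a_def)
  have gap: "(a + r) * (a - r) = c * (1 - s)"
    using rad_gap[of p s] assms by (simp add: r_def a_def c_def)
  have c: "c > 0" using assms by (simp add: c_def)
  have "(log_slope p has_real_derivative c / (2 * r) * (a / ((a + r) * (a - r)) - log_slope p s) / r) (at s)"
    using DERIV_log_ratio[OF DERIV_rad[OF assms], of a] r
    by (simp add: log_slope_def[abs_def] r_def a_def c_def)
  also have "c / (2 * r) * (a / ((a + r) * (a - r)) - log_slope p s) / r = (a / (1 - s) - c * log_slope p s) / (2 * r\<^sup>2)"
    unfolding gap using r(1) c assms(4) by (simp add: power2_eq_square field_simps)
  finally show ?thesis by (simp add: a_def c_def r_def)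
qed

lemma DERIV_log_slope_off:
  assumes "0 < s" "s < 1"
  shows "(log_slope_off has_real_derivative (1 / (1 - s) - log_slope_off s) / (2 * s)) (at s)"
proof -
  define t where "t = sqrt s"
  have t: "0 < t" "t < 1" and s: "t * t = s" using assms by (auto simp: t_def)
  have gap: "(1 + t) * (1 - t) = 1 - s"
    by (simp add: s[symmetric] algebra_simps)
  have "(log_slope_off has_real_derivative inverse t / 2 * (1 / ((1 + t) * (1 - t)) - log_slope_off s) / t) (at s)"
    using DERIV_log_ratio[OF DERIV_real_sqrt[OF assms(1)], of 1] t
    by (simp add: log_slope_off_def[abs_def] t_def)
  also have "inverse t / 2 * (1 / ((1 + t) * (1 - t)) - log_slope_off s) / t = (1 / (1 - s) - log_slope_off s) / (2 * (t * t))"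
  proof -
    have "inverse t / 2 * X / t = X / (2 * (t * t))" for X
      using t by (simp add: field_simps)
    then show ?thesis by (simp only: gap)
  qed
  finally show ?thesis by (simp only: s)
qed

lemma DERIV_log_mean:
  assumes "s < 1"
  shows "(log_mean p has_real_derivative - 1 / (2 * (1 - s))) (at s)"
proof -
  have "(log_mean p has_real_derivative 0 + 1 / (1 - s) * (0 - 1) / 2) (at s)"
    unfolding log_mean_def[abs_def] using assms
    by (intro DERIV_add DERIV_const DERIV_cdivide DERIV_chain2[OF DERIV_ln_divide] DERIV_diff DERIV_ident) auto
  then show ?thesis by (simp add: mult.commute)
qed

text \<open>
  The first summand of the derivative is half the coefficient of \<open>\<Omega>\<close> along the Bloch vector, so the
  second one measures how far the gradient is from \<open>\<Omega>\<close>.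
\<close>

lemma DERIV_isotropic_part:
  assumes "0 < p" "p < 1" "0 < s" "s < 1"
  shows "(isotropic_part p q has_real_derivative
    (q * (p/2 * log_slope p s) + (1 - q) * log_slope_off s) / 2
     - q * (p/2) * (1 - p) * ((1 - p/2) * log_slope p s - 1) / (2 * (rad p s)\<^sup>2)) (at s)"
proof -
  let ?a = "1 - p/2" and ?c = "p * (1 - 3 * p / 4)" and ?w = "log_slope p s" and ?y = "log_slope_off s"
  define v where "v = (rad p s)\<^sup>2"
  define w' where "w' = (?a / (1 - s) - ?c * ?w) / (2 * v)"
  define y' where "y' = (1 / (1 - s) - ?y) / (2 * s)"
  define m' where "m' = - 1 / (2 * (1 - s))"
  have v: "0 < v" using rad_pos[of p s] assms by (simp add: v_def)
  have vs: "v = (1 - p)\<^sup>2 + ?c * s"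
    using rad_square[of p s] assms by (simp add: v_def)
  have "(log_slope p has_real_derivative w') (at s)" "(log_slope_off has_real_derivative y') (at s)"
    "(log_mean p has_real_derivative m') (at s)"
    using DERIV_log_slope[of p s] DERIV_log_slope_off[of s] DERIV_log_mean[of s p] assms
    by (simp_all add: w'_def y'_def m'_def v_def)
  then have "(isotropic_part p q has_real_derivative
      q * (m' + (p/2 * ?w + (1 - p + p/2 * s) * w')) + (1 - q) * (m' + (y' * s + ?y))) (at s)"
    unfolding isotropic_part_def[abs_def]
    by (auto intro!: derivative_eq_intros simp: algebra_simps)
  also have "m' + (p/2 * ?w + (1 - p + p/2 * s) * w') = p/4 * ?w - (p/2) * (1 - p) * (?a * ?w - 1) / (2 * v)"
  proof -
    \<comment> \<open>The identities \<open>v1\<close> and \<open>v2\<close> divide by v with simple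
      remainders. They isolate the pole 1/(2(1 - s)), which cancels against the derivative of
      \<open>log_mean\<close>.\<close>
    have "(1 - p + p/2 * s) * ?a - v = (p/2) * (1 - p) * (1 - s)"
      unfolding vs by (simp add: power2_eq_square field_simps)
    then have v1: "(1 - p + p/2 * s) * ?a = v + (p/2) * (1 - p) * (1 - s)" by simp
    have v2: "(1 - p + p/2 * s) * ?c = p/2 * v + (p/2) * (1 - p) * ?a"
      unfolding vs by (simp add: power2_eq_square field_simps)
    have "(1 - p + p/2 * s) * w' = ((1 - p + p/2 * s) * ?a / (1 - s) - (1 - p + p/2 * s) * ?c * ?w) / (2 * v)"
      by (simp add: w'_def right_diff_distrib mult.assoc)
    also have "\<dots> = 1 / (2 * (1 - s)) + (p/2) * (1 - p) / (2 * v) - p/4 * ?w - (p/2) * (1 - p) * ?a * ?w / (2 * v)"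
      unfolding v1 v2 using v assms by (simp add: divide_simps) (simp add: algebra_simps)
    finally have e1: "(1 - p + p/2 * s) * w' = 1 / (2 * (1 - s)) + (p/2) * (1 - p) / (2 * v) - p/4 * ?w
        - (p/2) * (1 - p) * ?a * ?w / (2 * v)" .
    have e2: "(p/2) * (1 - p) * (?a * ?w - 1) / (2 * v)
        = (p/2) * (1 - p) * ?a * ?w / (2 * v) - (p/2) * (1 - p) / (2 * v)"
    proof -
      have "A * (B - 1) / D = A * B / D - A / D" for A B D :: real
        by (simp add: right_diff_distrib diff_divide_distrib)
      from this[of "(p/2) * (1 - p)" "?a * ?w" "2 * v"] show ?thesis
        by (simp only: mult.assoc)
    qed
    have "m' + (P' + E) = P - Q" if "E = X1 + X2 - P - X3" "Q = X3 - X2" "m' = - X1" "P' = P + P"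
      for E P P' Q X1 X2 X3
      using that by simp
    from this[OF e1 e2] show ?thesis by (simp add: m'_def)
  qed
  also have "m' + (y' * s + ?y) = ?y / 2"
  proof -
    have "y' * s = (1 / (1 - s) - ?y) / 2" using assms(3) by (simp add: y'_def)
    moreover have "m' = - (1 / (1 - s)) / 2" by (simp add: m'_def mult.commute)
    ultimately show ?thesis by (simp only:) (simp add: diff_divide_distrib)
  qed
  also have "q * (p/4 * ?w - p/2 * (1 - p) * B / D) + (1 - q) * (?y/2)
      = (q * (p/2 * ?w) + (1 - q) * ?y) / 2 - q * (p/2) * (1 - p) * B / D" for B D
    by (simp add: algebra_simps add_divide_distrib diff_divide_distrib)
  finally show ?thesis
    by (simp add: v_def)
qed

text \<open>Arranged so that the poles at s = 1 from the derivatives of the two slopes have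
  cancelled; only the logarithmic growth of the slopes remains there.\<close>

definition axial_deriv :: "real \<Rightarrow> real \<Rightarrow> real" where
  "axial_deriv p s = log_slope_off s / (2 * s) - (1 - p) * (2 - 3/2 * p) / (2 * s * (rad p s)\<^sup>2)
     - p * (1 - 3 * p / 4) * log_slope p s * (2 - 3/2 * p - (1 - p) / s) / (2 * (rad p s)\<^sup>2)
     - (log_offset p - (1 - p) * log_slope p s) / s\<^sup>2"

lemma DERIV_axial_part:
  assumes "0 < p" "p < 1" "0 < s" "s < 1"
  shows "(axial_part p has_real_derivative axial_deriv p s) (at s)"
proof -
  let ?a = "1 - p/2" and ?c = "p * (1 - 3 * p / 4)" and ?w = "log_slope p s" and ?y = "log_slope_off s"
  let ?e = "2 - 3/2 * p" and ?k = "log_offset p"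
  define v where "v = (rad p s)\<^sup>2"
  define w' where "w' = (?a / (1 - s) - ?c * ?w) / (2 * v)"
  define y' where "y' = (1 / (1 - s) - ?y) / (2 * s)"
  have v: "0 < v" using rad_pos[of p s] assms by (simp add: v_def)
  have vs: "v = (1 - p)\<^sup>2 + ?c * s"
    using rad_square[of p s] assms by (simp add: v_def)
  have "(log_slope p has_real_derivative w') (at s)" "(log_slope_off has_real_derivative y') (at s)"
    using DERIV_log_slope[of p s] DERIV_log_slope_off[of s] assms
    by (simp_all add: w'_def y'_def v_def)
  then have "(axial_part p has_real_derivative
      (- ((1 - p) * w') * s - (?k - (1 - p) * ?w)) / (s * s) + ?e * w' - y') (at s)"
    unfolding axial_part_def[abs_def] using assms(3)
    by (auto intro!: derivative_eq_intros)
  also have "(- ((1 - p) * w') * s - (?k - (1 - p) * ?w)) / (s * s) + ?e * w' - y'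
      = w' * (?e - (1 - p) / s) - y' - (?k - (1 - p) * ?w) / s\<^sup>2"
    using assms(3) by (simp add: power2_eq_square field_simps)
  also have "w' * (?e - (1 - p) / s) = ?a * (?e - (1 - p) / s) / ((1 - s) * (2 * v))
      - ?c * ?w * (?e - (1 - p) / s) / (2 * v)"
    using v assms by (simp add: w'_def field_simps)
  also have "?a * (?e - (1 - p) / s) / ((1 - s) * (2 * v)) = 1 / ((1 - s) * (2 * s)) - (1 - p) * ?e / (2 * s * v)"
  proof -
    \<comment> \<open>This yields the partial fraction whose pole at s = 1 cancels the one in
      \<open>y'\<close>.\<close>
    have "?a * (?e * s - (1 - p)) = v - (1 - p) * ?e * (1 - s)"
      unfolding vs by (simp add: power2_eq_square field_simps)
    moreover have "?a * (?e - (1 - p) / s) = ?a * (?e * s - (1 - p)) / s"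
      using assms(3) by (simp add: field_simps)
    ultimately have "?a * (?e - (1 - p) / s) / ((1 - s) * (2 * v)) = (v - (1 - p) * ?e * (1 - s)) / s / ((1 - s) * (2 * v))"
      by simp
    also have "\<dots> = 1 / ((1 - s) * (2 * s)) - (1 - p) * ?e / (2 * s * v)"
      using v assms by (simp add: divide_simps) (simp add: algebra_simps)
    finally show ?thesis .
  qed
  finally show ?thesis
    using assms by (simp add: axial_deriv_def v_def[symmetric] y'_def diff_divide_distrib algebra_simps)
qed

section \<open>The sign of the mismatch\<close>

text \<open>
  \<open>Tr(\<sigma>\<^sub>j (\<Omega> - \<nabla>f)) / (2 r\<^sub>j)\<close> for \<open>j \<in> {x, y}\<close>, with \<open>Z = r\<^sub>z\<^sup>2\<close>.
\<close>

definition mismatch :: "real \<Rightarrow> real \<Rightarrow> real \<Rightarrow> real \<Rightarrow> real" where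
  "mismatch p q s Z = q * (p/2) * (1 - p) * ((1 - p/2) * log_slope p s - 1) / (rad p s)\<^sup>2
     - 2 * (1 - q) * Z * axial_deriv p s"

lemma mismatch_eq:
  "mismatch p q s Z = q * (p/2) * (1 - p) * ((1 - p/2) * log_slope p s - 1) / (rad p s)\<^sup>2
     - 2 * (1 - q) * (Z * axial_deriv p s)"
  by (simp add: mismatch_def)

text \<open>This is artanh u > u at u = r/a. The difference of the two sides vanishes at r = 0 and
  has positive derivative.\<close>

lemma ln_ratio_gt:
  assumes "0 < r" "r < (a::real)"
  shows "2 * r / a < ln (a + r) - ln (a - r)"
proof -
  define h where "h = (\<lambda>t. ln (a + t) - ln (a - t) - 2 * t / a)"
  have "h 0 < h r"
  proof (rule DERIV_pos_imp_increasing_open[OF assms(1)])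
    fix t assume t: "0 < t" "t < r"
    have "(h has_real_derivative 1 / (a + t) + 1 / (a - t) - 2 / a) (at t)"
      unfolding h_def using t assms
      by (auto intro!: derivative_eq_intros)
    moreover have "1 / (a + t) + 1 / (a - t) - 2 / a = 2 * t\<^sup>2 / (a * ((a + t) * (a - t)))"
      using t assms by (simp add: divide_simps) (simp add: power2_eq_square algebra_simps)
    moreover have "0 < 2 * t\<^sup>2 / (a * ((a + t) * (a - t)))"
      using t assms by simp
    ultimately show "\<exists>y. (h has_real_derivative y) (at t) \<and> 0 < y" by metis
  next
    show "continuous_on {0..r} h"
      unfolding h_def using assms by (intro continuous_intros) auto
  qed
  then show ?thesis by (simp add: h_def)
qed

lemma log_slope_gt:
  assumes "0 < p" "p < 1" "0 \<le> s" "s < 1"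
  shows "1 < (1 - p/2) * log_slope p s"
proof -
  let ?r = "rad p s" and ?a = "1 - p/2"
  have r: "0 < ?r" "?r < ?a"
    using rad_pos[OF assms] rad_bounds(2)[OF assms] by simp_all
  have "1 = ?a * (2 * ?r / ?a / (2 * ?r))" using r by simp
  also have "\<dots> < ?a * log_slope p s"
    unfolding log_slope_def
    using r ln_ratio_gt[OF r] by (intro mult_strict_left_mono divide_strict_right_mono) auto
  finally show ?thesis .
qed

lemma mismatch_0_pos:
  assumes "0 < p" "p < 1" "0 < q" "0 \<le> s" "s < 1"
  shows "0 < mismatch p q s 0"
  using log_slope_gt[of p s] rad_pos[of p s] assms by (simp add: mismatch_def)

section \<open>Numerical bounds for p = 1/20 and q = 2/5\<close>

lemma ln_ge_one_minus_inverse: "0 < x \<Longrightarrow> 1 - 1 / x \<le> ln x" for x :: real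
  using ln_le_minus_one[of "1/x"] by (simp add: ln_div)

text \<open>At p = 1/20, \<open>log_offset\<close> is ln 77 / 2, and at s = 153/308 the eigenvalue
  ratio behind \<open>log_slope\<close> is 155. Splitting off 2^6 and 2^7 leaves factors near 1,
  where 1 - 1/x \<le> ln x \<le> x - 1 suffices.\<close>

lemma ln_numeric_bounds:
  "ln (155::real) \<le> (5073/1000)" "(121/25) \<le> ln (155::real)" "(521/125) \<le> ln (77::real)" "ln (77::real) \<le> (22/5)"
proof -
  have "ln (155::real) = ln (2 ^ 7) + ln (155/128)"
    using ln_mult_pos[of "2 ^ 7" "155/128 :: real"] by simp
  then have a: "ln (155::real) = 7 * ln 2 + ln (155/128)"
    using ln_realpow[of "2::real" 7] by simp
  have "ln (77::real) = ln (2 ^ 6) + ln (77/64)"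
    using ln_mult_pos[of "2 ^ 6" "77/64 :: real"] by simp
  then have b: "ln (77::real) = 6 * ln 2 + ln (77/64)"
    using ln_realpow[of "2::real" 6] by simp
  note ln2_ge_two_thirds ln2_le_25_over_36
    ln_le_minus_one[of "155/128"] ln_ge_one_minus_inverse[of "155/128"]
    ln_le_minus_one[of "77/64"] ln_ge_one_minus_inverse[of "77/64"]
  then show "ln (155::real) \<le> (5073/1000)" "(121/25) \<le> ln (155::real)" "(521/125) \<le> ln (77::real)" "ln (77::real) \<le> (22/5)"
    unfolding a b by simp_all
qed

text \<open>The interval for s encloses 153/308, whose root is about 0.7048; numerator and
  denominator are bounded at opposite ends.\<close>

lemma log_slope_off_le:
  assumes "(7/10)\<^sup>2 \<le> s" "s \<le> (71/100)\<^sup>2"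
  shows "log_slope_off s \<le> (1331/1000)"
proof -
  define t where "t = sqrt s"
  have t: "(7/10) \<le> t" "t \<le> (71/100)"
    using real_le_rsqrt[OF assms(1)] real_sqrt_le_mono[OF assms(2)] by (simp_all add: t_def)
  have "ln (1 + t) - ln (1 - t) = ln ((1 + t) / (1 - t))" using t by (simp add: ln_div)
  also have "\<dots> \<le> ln (171/29)"
    using t by (subst ln_le_cancel_iff) (auto simp: field_simps)
  also have "\<dots> = 2 * ln 2 + ln (171/116)"
    using ln_mult_pos[of "2 ^ 2" "171/116 :: real"] ln_realpow[of "2::real" 2] by simp
  also have "\<dots> \<le> 18631/10000"
    using ln2_le_25_over_36 ln_le_minus_one[of "171/116"] by simp
  finally have "(ln (1 + t) - ln (1 - t)) / (2 * t) \<le> (18631/10000) / (2 * t)"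
    using t by (intro divide_right_mono) auto
  also have "\<dots> \<le> (18631/10000) / (2 * (7/10))"
    using t by (intro divide_left_mono) auto
  also have "\<dots> \<le> 1331/1000" by simp
  finally show ?thesis unfolding log_slope_off_def t_def .
qed

text \<open>At \<open>s = 153/308\<close> the number \<open>rad (1/20) s\<close> is rational, namely \<open>77/80\<close>.\<close>

lemma mismatch_pos_small:
  assumes "0 \<le> Z" "Z \<le> 1/100"
  shows "0 < mismatch (1/20) (2/5) (153/308) Z"
proof -
  let ?p = "(1/20) :: real" and ?s = "153/308 :: real"
  have rad: "rad ?p ?s = 77/80"
    unfolding rad_def by (rule real_sqrt_unique) (simp_all add: power2_eq_square)
  have w: "log_slope ?p ?s = 40/77 * ln 155"
    using ln_div[of "31/16" "1/80 :: real"] by (simp add: log_slope_def rad)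
  have k: "log_offset ?p = ln 77 / 2"
    using ln_div[of "77/20" "1/20 :: real"] by (simp add: log_offset_def)
  note bounds = ln_numeric_bounds log_slope_off_le[of ?s]
  have "axial_deriv ?p ?s \<le> (6/5)"
    unfolding axial_deriv_def rad w k using bounds by (simp add: power2_eq_square field_simps)
  then have "Z * axial_deriv ?p ?s \<le> Z * (6/5)"
    using assms by (intro mult_left_mono) auto
  also have "\<dots> \<le> (3/250)" using assms by simp
  finally have "Z * axial_deriv ?p ?s \<le> (3/250)" .
  define P where "P = (2/5) * (?p/2) * (1 - ?p) * ((1 - ?p/2) * log_slope ?p ?s - 1) / (rad ?p ?s)\<^sup>2"
  \<comment> \<open>The first term of \<open>mismatch\<close> is thus at least 0.0145, while the
    subtracted one is at most 2 (3/5) (3/250) = 0.0144.\<close>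
  have "29/2000 \<le> P"
    unfolding P_def rad w using bounds by (simp add: power2_eq_square field_simps)
  with \<open>Z * axial_deriv ?p ?s \<le> 3/250\<close> show ?thesis
    unfolding mismatch_eq P_def[symmetric] by simp
qed

text \<open>Both terms of \<open>mismatch\<close> grow linearly in the slope w. The first is at most
  0.01027 w; the subtracted one is at least 2 (3/5) (1/100) 0.8897 w, about 0.01068 w, and
  wins.\<close>

lemma mismatch_neg_large:
  assumes "1/100 \<le> Z" "(9/10) \<le> s" "s < 1" and w: "100 \<le> log_slope (1/20) s"
  shows "mismatch (1/20) (2/5) s Z < 0"
proof -
  define w where "w = log_slope (1/20) s"
  define v where "v = (rad (1/20) s)\<^sup>2"
  have w100: "100 \<le> w" using w by (simp add: w_def)
  have v: "(361/400) \<le> v"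
    using assms rad_square[of "1/20" s] by (simp add: v_def power2_eq_square)
  have "0 < sqrt s" "sqrt s < 1" using assms by simp_all
  then have "ln (1 - sqrt s) \<le> ln (1 + sqrt s)" by (subst ln_le_cancel_iff) linarith+
  then have y: "0 \<le> log_slope_off s"
    using assms by (simp add: log_slope_off_def)
  have k: "log_offset (1/20) \<le> (11/5)"
    using ln_numeric_bounds ln_div[of "77/20" "1/20 :: real"] by (simp add: log_offset_def)
  have s2: "(81/100) \<le> s\<^sup>2" "s\<^sup>2 \<le> 1"
    using assms power_mono[of "9/10" s 2] power_le_one[of s 2] by (simp_all add: power2_eq_square)
  have t1: "(19/20) * (77/40) / (2 * s * v) \<le> (113/100)"
  proof -
    have "(9/10) * (361/400) \<le> s * v" using assms v by (intro mult_mono) auto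
    then show ?thesis using assms v by (simp add: field_simps)
  qed
  have t2: "(77/1600) * w * ((77/40) - (19/20) / s) / (2 * v) \<le> (27/1000) * w"
  proof -
    have "(77/40) - (19/20) / s \<le> (39/40)" using assms by (simp add: field_simps)
    then have "(77/1600) * w * ((77/40) - (19/20) / s) / (2 * v) \<le> (77/1600) * w * (39/40) / (2 * v)"
      using w100 v by (intro divide_right_mono mult_left_mono) auto
    also have "\<dots> \<le> (77/1600) * w * (39/40) / (2 * (361/400))"
      using w100 v by (intro divide_left_mono) auto
    also have "\<dots> \<le> (27/1000) * w" using w100 by simp
    finally show ?thesis .
  qed
  have t3: "(19/20) * w - (11/5) \<le> ((19/20) * w - log_offset (1/20)) / s\<^sup>2"
  proof -
    have "((19/20) * w - (11/5)) * s\<^sup>2 \<le> ((19/20) * w - (11/5)) * 1"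
      using w100 s2 by (intro mult_left_mono) auto
    also have "\<dots> \<le> (19/20) * w - log_offset (1/20)" using k by simp
    finally have "(19/20 * w - 11/5) * s\<^sup>2 \<le> 19/20 * w - log_offset (1/20)" .
    moreover have "0 < s\<^sup>2" using s2 by linarith
    ultimately show ?thesis by (simp only: pos_le_divide_eq)
  qed
  have t4: "0 \<le> log_slope_off s / (2 * s)" using y assms by simp
  have "axial_deriv (1/20) s = log_slope_off s / (2 * s) - (19/20) * (77/40) / (2 * s * v)
      - (77/1600) * w * ((77/40) - (19/20) / s) / (2 * v) + ((19/20) * w - log_offset (1/20)) / s\<^sup>2"
    by (simp add: axial_deriv_def w_def v_def diff_divide_distrib)
  \<comment> \<open>The threshold 100 for w is exactly what makes 0.95 w - 0.027 w - 2.2 - 1.13 at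
    least 0.8897 w.\<close>
  then have E: "(8897/10000) * w \<le> axial_deriv (1/20) s"
    using t1 t2 t3 t4 w100 by linarith
  have "(1/100) * ((8897/10000) * w) \<le> Z * axial_deriv (1/20) s"
    using E assms w100 by (intro mult_mono) auto
  moreover define P where "P = 2/5 * (1/20/2) * (1 - 1/20) * ((1 - 1/20/2) * w - 1) / v"
  have "P \<le> 2/5 * (1/20/2) * (1 - 1/20) * ((1 - 1/20/2) * w - 1) / (361/400)"
    unfolding P_def using w100 v by (intro divide_left_mono) auto
  then have "P \<le> 1027/100000 * w" using w100 by simp
  ultimately show ?thesis
    using w100 unfolding mismatch_eq w_def[symmetric] v_def[symmetric] P_def[symmetric] by simp
qed

text \<open>With a = 1 - p/2 and r the radius, (a + r)(a - r) \<le> 1 - s and a + r \<ge> 1 give a -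
  r \<le> 1 - s, so the numerator is at least - ln (1 - s); the denominator 2 r is below 2.\<close>

lemma log_slope_unbounded:
  assumes "0 < p" "p \<le> 1/2" "0 \<le> s" "s < 1"
  shows "- ln (1 - s) / 2 \<le> log_slope p s"
proof -
  let ?r = "rad p s" and ?a = "1 - p/2" and ?c = "p * (1 - 3 * p / 4)"
  have r: "0 < ?r" "?r < ?a" "1 - p \<le> ?r"
    using rad_pos[of p s] rad_bounds[of p s] assms by simp_all
  have ge1: "1 \<le> ?a + ?r" using r assms by simp
  have "?c \<le> 1 * 1" using assms by (intro mult_mono) auto
  then have "?c * (1 - s) \<le> 1 * (1 - s)" using assms by (intro mult_right_mono) auto
  moreover have "1 * (?a - ?r) \<le> (?a + ?r) * (?a - ?r)"
    using ge1 r by (intro mult_right_mono) auto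
  ultimately have "?a - ?r \<le> 1 - s"
    using rad_gap[OF assms(1) _ assms(3)] assms(2) by simp
  then have "ln (?a - ?r) \<le> ln (1 - s)" using r assms by simp
  moreover have "0 \<le> ln (?a + ?r)" using ge1 by simp
  ultimately have "- ln (1 - s) \<le> ln (?a + ?r) - ln (?a - ?r)" by simp
  moreover have "ln (1 - s) \<le> 0" using assms by simp
  ultimately have "- ln (1 - s) / 2 * (2 * ?r) \<le> ln (?a + ?r) - ln (?a - ?r)"
  proof -
    have "- ln (1 - s) * ?r \<le> - ln (1 - s) * 1"
      using \<open>ln (1 - s) \<le> 0\<close> r assms by (intro mult_left_mono) auto
    with \<open>- ln (1 - s) \<le> ln (?a + ?r) - ln (?a - ?r)\<close> show ?thesis by simp
  qed
  then show ?thesis using r by (simp add: log_slope_def pos_le_divide_eq)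
qed

lemma exists_mismatch:
  assumes "0 \<le> Z" "Z < 1"
  obtains s where "Z < s" "0 < s" "s < 1" "mismatch (1/20) (2/5) s Z \<noteq> 0"
proof (cases "Z \<le> 1/100")
  case True
  show thesis
    by (rule that[of "153/308"]) (use True assms mismatch_pos_small[of Z] in auto)
next
  case False
  define e where "e = (1 - Z) / 2"
  \<comment> \<open>For s = 1 - d the three bounds give s \<ge> 9/10, s > Z, and slope at least 100
    through - ln d / 2.\<close>
  define d where "d = min (1/10) (min e (exp (- 200)))"
  have e: "0 < e" "e < 1 - Z" using assms by (simp_all add: e_def)
  then have d: "0 < d" "d \<le> 1/10" "d \<le> e" "d \<le> exp (- 200)"
    by (auto simp: d_def)
  have "ln d \<le> ln (exp (- 200))" using d by (subst ln_le_cancel_iff) auto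
  then have "100 \<le> log_slope (1/20) (1 - d)"
    using log_slope_unbounded[of "1/20" "1 - d"] d by simp
  then have "mismatch (1/20) (2/5) (1 - d) Z < 0"
    using d False by (intro mismatch_neg_large) auto
  then show thesis
    by (intro that[of "1 - d"]) (use d e assms in auto)
qed

section \<open>The gradient\<close>

text \<open>As q is not 1/2, the radicand is at least (1 - 2q)^2 > 0, so the root is differentiable
  even at z = 0. The value of the derivative is left open, since it only affects the \<sigma>_z
  component of the gradient.\<close>

lemma dephasing_entropy_differentiable:
  assumes q: "0 < q" "q < 1" "q \<noteq> 1/2" and z: "z\<^sup>2 < 1"
  shows "\<exists>e. (dephasing_entropy q has_real_derivative e) (at z)"
proof -
  define m where "m = (\<lambda>z. sqrt (1 - 4 * q * (1 - q) * (1 - z\<^sup>2)))"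
  have m1: "m z < 1" "0 \<le> m z"
    using dephasing_gram_eigenvalues[OF q(1,2) z refl] by (simp_all add: m_def)
  have "0 < (1 - 2 * q)\<^sup>2" using q by simp
  moreover have "(1 - 2 * q)\<^sup>2 = 1 - 4 * q * (1 - q)" by (simp add: power2_eq_square algebra_simps)
  moreover have "4 * q * (1 - q) * (1 - z\<^sup>2) \<le> 4 * q * (1 - q) * 1"
    using q z by (intro mult_left_mono) auto
  ultimately have pos: "0 < 1 - 4 * q * (1 - q) * (1 - z\<^sup>2)" by linarith
  have "\<exists>d. (m has_real_derivative d) (at z)"
    unfolding m_def using pos
    by (intro exI DERIV_chain2[OF DERIV_real_sqrt]) (auto intro!: derivative_eq_intros)
  then obtain d where d: "(m has_real_derivative d) (at z)" ..
  have xlnx: "((\<lambda>x. x * ln x) has_real_derivative ln x + 1) (at x)" if "0 < x" for x :: real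
    using that by (auto intro!: derivative_eq_intros)
  have u: "((\<lambda>z. (1 + m z) / 2) has_real_derivative (0 + d) / 2) (at z)"
    and v: "((\<lambda>z. (1 - m z) / 2) has_real_derivative (0 - d) / 2) (at z)"
    by (intro DERIV_cdivide DERIV_add DERIV_diff DERIV_const d)+
  have "((\<lambda>z. - ((1 + m z)/2 * ln ((1 + m z)/2) + (1 - m z)/2 * ln ((1 - m z)/2))) has_real_derivative
      - ((ln ((1 + m z)/2) + 1) * ((0 + d) / 2) + (ln ((1 - m z)/2) + 1) * ((0 - d) / 2))) (at z)"
    using m1 by (intro DERIV_minus DERIV_add DERIV_chain2[OF xlnx u] DERIV_chain2[OF xlnx v]) auto
  then show ?thesis
    unfolding dephasing_entropy_def[abs_def] Let_def m_def by blast
qed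

text \<open>The partial derivative of f in s at fixed z, with Z = z^2.\<close>

definition radial_deriv :: "real \<Rightarrow> real \<Rightarrow> real \<Rightarrow> real \<Rightarrow> real" where
  "radial_deriv p q s Z = (q * (p/2 * log_slope p s) + (1 - q) * log_slope_off s) / 2
     - q * (p/2) * (1 - p) * ((1 - p/2) * log_slope p s - 1) / (2 * (rad p s)\<^sup>2)
     + (1 - q) * (Z * axial_deriv p s)"

text \<open>Along \<sigma>_j, \<Omega> contributes 2 r_j times the first two summands, and the
  gradient 4 r_j times \<open>radial_deriv\<close>; their difference is 2 r_j times the
  mismatch.\<close>

lemma mismatch_radial_deriv:
  "q * (p/2 * log_slope p s) + (1 - q) * log_slope_off s - 2 * radial_deriv p q s Z = mismatch p q s Z"
proof -
  have "W - 2 * (W / 2 - B / (2 * D) + C * X) = B / D - 2 * C * X" for W B C D X :: real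
    by (simp add: algebra_simps)
  then show ?thesis by (simp only: radial_deriv_def mismatch_eq)
qed

text \<open>Chain rule for the closed form in s and z. The constant c collects the derivative in z
  at fixed s and can stay unspecified, as it multiplies only the z coordinate.\<close>

lemma has_derivative_neg_relative_entropy:
  fixes x y z p q :: real
  defines "s \<equiv> x\<^sup>2 + y\<^sup>2 + z\<^sup>2"
  assumes p: "0 < p" "p < 1" and q: "0 < q" "q < 1" "q \<noteq> 1/2" and s: "0 < s" "s < 1"
  obtains c where "(neg_relative_entropy (dephasing q) (depolarizing p) has_derivative
    (\<lambda>X. radial_deriv p q s (z\<^sup>2) * (2 * x * pauli_coord pauli_x X + 2 * y * pauli_coord pauli_y X
      + 2 * z * pauli_coord pauli_z X) + c * pauli_coord pauli_z X))
    (at (bloch x y z) within {\<sigma>. density_operator \<sigma>})"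
proof -
  let ?D = "{\<sigma>. density_operator \<sigma>} :: (complex^2^2) set" and ?\<rho> = "bloch x y z"
  let ?x = "pauli_coord pauli_x" and ?y = "pauli_coord pauli_y" and ?z = "pauli_coord pauli_z"
  define sq where "sq = (\<lambda>A. (?x A)\<^sup>2 + (?y A)\<^sup>2 + (?z A)\<^sup>2)"
  define F where "F = (\<lambda>A. dephasing_entropy q (?z A) + isotropic_part p q (sq A)
    + (1 - q) * ((?z A)\<^sup>2 * axial_part p (sq A)))"
  have sq\<rho>: "sq ?\<rho> = s" by (simp add: sq_def pauli_coord_bloch s_def)
  have z: "z\<^sup>2 < 1" using s bloch_sq_bound by (simp add: s_def)
  obtain e where e: "(dephasing_entropy q has_real_derivative e) (at z)"
    using dephasing_entropy_differentiable[OF q z] ..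
  have coord: "(pauli_coord P has_derivative pauli_coord P) (at A within S)" for P A S
    by (rule bounded_linear_imp_has_derivative[OF bounded_linear_pauli_coord])
  let ?s' = "\<lambda>X. 2 * x * ?x X + 2 * y * ?y X + 2 * z * ?z X"
  have dsq: "(sq has_derivative ?s') (at ?\<rho> within ?D)"
    unfolding sq_def by (auto intro!: derivative_eq_intros coord simp: pauli_coord_bloch)
  have d1: "((\<lambda>A. dephasing_entropy q (?z A)) has_derivative (\<lambda>X. ?z X * e)) (at ?\<rho> within ?D)"
    by (rule DERIV_compose_FDERIV[OF _ coord]) (simp add: pauli_coord_bloch e)
  define K where "K = (q * (p/2 * log_slope p s) + (1 - q) * log_slope_off s) / 2
     - q * (p/2) * (1 - p) * ((1 - p/2) * log_slope p s - 1) / (2 * (rad p s)\<^sup>2)"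
  have K: "radial_deriv p q s (z\<^sup>2) = K + (1 - q) * (z\<^sup>2 * axial_deriv p s)"
    by (simp only: radial_deriv_def K_def)
  have d2: "((\<lambda>A. isotropic_part p q (sq A)) has_derivative (\<lambda>X. ?s' X * K)) (at ?\<rho> within ?D)"
    by (rule DERIV_compose_FDERIV[OF _ dsq])
      (simp only: sq\<rho> K_def DERIV_isotropic_part[OF p s])
  have d3: "((\<lambda>A. axial_part p (sq A)) has_derivative (\<lambda>X. ?s' X * axial_deriv p s)) (at ?\<rho> within ?D)"
    by (rule DERIV_compose_FDERIV[OF _ dsq]) (simp only: sq\<rho> DERIV_axial_part[OF p s])
  let ?c = "e + (1 - q) * (2 * z * axial_part p s)"
  have F: "(F has_derivative (\<lambda>X. radial_deriv p q s (z\<^sup>2) * ?s' X + ?c * ?z X)) (at ?\<rho> within ?D)"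
    unfolding F_def
    by (rule derivative_eq_intros d1 d2 d3 coord refl)+
      (simp add: fun_eq_iff pauli_coord_bloch sq\<rho> K algebra_simps)
  \<comment> \<open>The closed form is available only for states with 0 < s < 1; continuity of
    \<open>sq\<close> provides a neighbourhood of the base point where this holds.\<close>
  have "continuous_on UNIV sq"
    unfolding sq_def
    by (intro continuous_intros linear_continuous_on bounded_linear_pauli_coord)
  then have "open {A. 0 < sq A \<and> sq A < 1}"
    by (intro open_Collect_conj open_Collect_less continuous_on_const)
  moreover have "?\<rho> \<in> {A. 0 < sq A \<and> sq A < 1}" using s by (simp add: sq\<rho>)
  ultimately obtain d where d: "0 < d" "\<And>A. dist A ?\<rho> < d \<Longrightarrow> 0 < sq A \<and> sq A < 1"
    unfolding open_dist by blast
  have "(neg_relative_entropy (dephasing q) (depolarizing p) has_derivative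
      (\<lambda>X. radial_deriv p q s (z\<^sup>2) * ?s' X + ?c * ?z X)) (at ?\<rho> within ?D)"
  proof (rule has_derivative_transform_within[OF F d(1)])
    show "?\<rho> \<in> ?D" using s by (simp add: density_operator_bloch s_def)
    fix A assume "A \<in> ?D" and "dist A ?\<rho> < d"
    then have A: "A = bloch (?x A) (?y A) (?z A)" and "0 < sq A" "sq A < 1"
      using bloch_pauli_coord d(2) by blast+
    then show "F A = neg_relative_entropy (dephasing q) (depolarizing p) A"
      using Omega1_dephasing_depolarizing(1)[OF p q(1,2), of "?x A" "?y A" "?z A"]
      by (simp add: F_def sq_def)
  qed
  then show thesis by (rule that)
qed

text \<open>The states have empty interior in the matrix space, so uniqueness is obtained along
  lines: through a state of Bloch radius below 1, a line in a traceless Hermitian direction stays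
  among the states for small t.\<close>

lemma derivative_unique_on_states:
  fixes f :: "complex^2^2 \<Rightarrow> real"
  assumes D: "(f has_derivative D) (at (bloch x y z) within {\<sigma>. density_operator \<sigma>})"
    and D': "(f has_derivative D') (at (bloch x y z) within {\<sigma>. density_operator \<sigma>})"
    and "x\<^sup>2 + y\<^sup>2 + z\<^sup>2 < 1"
  shows "D (pauli_vec u v w) = D' (pauli_vec u v w)"
proof -
  define \<gamma> where "\<gamma> = (\<lambda>t. bloch x y z + t *\<^sub>R pauli_vec u v w)"
  define T where "T = {t. (x + 2 * t * u)\<^sup>2 + (y + 2 * t * v)\<^sup>2 + (z + 2 * t * w)\<^sup>2 < 1}"
  have \<gamma>: "\<gamma> t = bloch (x + 2 * t * u) (y + 2 * t * v) (z + 2 * t * w)" for t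
    by (simp add: \<gamma>_def bloch_def pauli_vec_def algebra_simps)
  have "open T"
    unfolding T_def by (intro open_Collect_less continuous_intros)
  have "0 \<in> T" using assms(3) by (simp add: T_def)
  have sub: "\<gamma> ` T \<subseteq> {\<sigma>. density_operator \<sigma>}"
    by (auto simp: \<gamma> T_def intro: density_operator_bloch)
  have d\<gamma>: "(\<gamma> has_derivative (\<lambda>t. t *\<^sub>R pauli_vec u v w)) (at 0 within T)"
    unfolding \<gamma>_def by (auto intro!: derivative_eq_intros)
  have \<gamma>0: "\<gamma> 0 = bloch x y z" by (simp add: \<gamma>_def)
  have "((\<lambda>t. f (\<gamma> t)) has_derivative (\<lambda>t. E (t *\<^sub>R pauli_vec u v w))) (at 0)"
    if "(f has_derivative E) (at (bloch x y z) within {\<sigma>. density_operator \<sigma>})" for E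
    using has_derivative_in_compose[OF d\<gamma>, of f E] has_derivative_subset[OF that sub]
    by (simp add: \<gamma>0 at_within_open[OF \<open>0 \<in> T\<close> \<open>open T\<close>])
  from has_derivative_unique[OF this[OF D] this[OF D']] show ?thesis
    by (metis scaleR_one)
qed

lemma hermitian_trace_mult_real:
  assumes "hermitian A" "hermitian B"
  shows "trace (A ** B) = of_real (Re (trace (A ** B)))"
proof -
  have "cnj (trace (A ** B)) = trace (dagger (A ** B))" by (simp add: trace_dagger)
  also have "\<dots> = trace (B ** A)"
    using assms by (simp add: dagger_mult hermitian_def)
  also have "\<dots> = trace (A ** B)" by (rule trace_mul_sym)
  finally show ?thesis
    by (simp add: complex_eq_iff)
qed

text \<open>The derivative is a real combination of Pauli coordinates, and the Pauli vector with the
  same coefficients represents it.\<close>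

lemma is_gradient_exists:
  fixes x y z p q :: real
  assumes p: "0 < p" "p < 1" and q: "0 < q" "q < 1" "q \<noteq> 1/2"
    and s: "0 < x\<^sup>2 + y\<^sup>2 + z\<^sup>2" "x\<^sup>2 + y\<^sup>2 + z\<^sup>2 < 1"
  shows "\<exists>G. is_gradient (neg_relative_entropy (dephasing q) (depolarizing p)) (bloch x y z) G"
proof -
  let ?K = "radial_deriv p q (x\<^sup>2 + y\<^sup>2 + z\<^sup>2) (z\<^sup>2)"
  obtain c where D: "(neg_relative_entropy (dephasing q) (depolarizing p) has_derivative
    (\<lambda>X. ?K * (2 * x * pauli_coord pauli_x X + 2 * y * pauli_coord pauli_y X
      + 2 * z * pauli_coord pauli_z X) + c * pauli_coord pauli_z X))
    (at (bloch x y z) within {\<sigma>. density_operator \<sigma>})"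
    using has_derivative_neg_relative_entropy[OF p q s] by blast
  let ?G = "pauli_vec (?K * (2 * x)) (?K * (2 * y)) (?K * (2 * z) + c)"
  have "of_real (?K * (2 * x * pauli_coord pauli_x X + 2 * y * pauli_coord pauli_y X
      + 2 * z * pauli_coord pauli_z X) + c * pauli_coord pauli_z X) = trace (X ** ?G)"
    if "hermitian X" for X
    using hermitian_trace_mult_real[OF that hermitian_pauli(1)]
      hermitian_trace_mult_real[OF that hermitian_pauli(2)]
      hermitian_trace_mult_real[OF that hermitian_pauli(3)]
    by (simp add: pauli_vec_def matrix_add_ldistrib matrix_mult_scaleR trace_add trace_scaleR
        pauli_coord_def algebra_simps)
  then show ?thesis
    unfolding is_gradient_def using D hermitian_pauli_vec by blast
qed

text \<open>P is orthogonal to 1 and H, so pairing with P annihilates the span. The pairing of P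
  with any gradient is forced by uniqueness of the derivative, which leaves a nonzero multiple of
  the mismatch.\<close>

lemma Omega_minus_gradient_notin_span:
  fixes x y z p q :: real
  assumes p: "0 < p" "p < 1" and q: "0 < q" "q < 1" "q \<noteq> 1/2"
    and s: "0 < x\<^sup>2 + y\<^sup>2 + z\<^sup>2" "x\<^sup>2 + y\<^sup>2 + z\<^sup>2 < 1"
    and mismatch: "mismatch p q (x\<^sup>2 + y\<^sup>2 + z\<^sup>2) (z\<^sup>2) \<noteq> 0"
    and P: "P = pauli_x \<and> x \<noteq> 0 \<or> P = pauli_y \<and> y \<noteq> 0" and H: "trace (P ** H) = 0"
    and G: "is_gradient (neg_relative_entropy (dephasing q) (depolarizing p)) (bloch x y z) G"
  shows "Omega (dephasing q) (depolarizing p) (bloch x y z) - G \<notin> span {mat 1, H}"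
proof
  let ?s = "x\<^sup>2 + y\<^sup>2 + z\<^sup>2" and ?\<Omega> = "Omega (dephasing q) (depolarizing p) (bloch x y z)"
  let ?K = "radial_deriv p q ?s (z\<^sup>2)"
  let ?W = "q * (p/2 * log_slope p ?s) + (1 - q) * log_slope_off ?s"
  assume "?\<Omega> - G \<in> span {mat 1, H}"
  then obtain k l where "?\<Omega> - G = k *\<^sub>R mat 1 + l *\<^sub>R H"
    by (auto simp: span_insert span_singleton algebra_simps)
  then have "trace (P ** (?\<Omega> - G)) = of_real k * trace P + of_real l * trace (P ** H)"
    by (simp add: matrix_add_ldistrib matrix_mult_scaleR trace_add trace_scaleR)
  moreover have "trace P = 0" using P by (auto simp: trace_def sum_2)
  ultimately have eq: "trace (P ** ?\<Omega>) = trace (P ** G)"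
    using H by (simp add: matrix_mult_diff_ldistrib trace_sub)
  obtain r where r: "r \<noteq> 0" and P': "P = pauli_x \<and> r = x \<or> P = pauli_y \<and> r = y" using P by blast
  obtain c where D': "(neg_relative_entropy (dephasing q) (depolarizing p) has_derivative
    (\<lambda>X. ?K * (2 * x * pauli_coord pauli_x X + 2 * y * pauli_coord pauli_y X
      + 2 * z * pauli_coord pauli_z X) + c * pauli_coord pauli_z X))
    (at (bloch x y z) within {\<sigma>. density_operator \<sigma>})"
    using has_derivative_neg_relative_entropy[OF p q s] by blast
  obtain D where D: "(neg_relative_entropy (dephasing q) (depolarizing p) has_derivative D)
      (at (bloch x y z) within {\<sigma>. density_operator \<sigma>})"
    and grad: "\<And>X. hermitian X \<Longrightarrow> trace X = 0 \<Longrightarrow> of_real (D X) = trace (X ** G)"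
    using G unfolding is_gradient_def by blast
  have "pauli_vec 1 0 0 = pauli_x" "pauli_vec 0 1 0 = pauli_y" by (simp_all add: pauli_vec_def)
  then have "D P = ?K * (4 * r)"
    using derivative_unique_on_states[OF D D' s(2), of 1 0 0]
      derivative_unique_on_states[OF D D' s(2), of 0 1 0] P'
    by (auto simp: pauli_coord_pauli)
  moreover have hP: "hermitian P" using P hermitian_pauli by auto
  ultimately have "trace (P ** G) = of_real (?K * (4 * r))"
    using grad[of P] \<open>trace P = 0\<close> by simp
  moreover have "trace (P ** ?\<Omega>) = of_real (2 * r * ?W)"
    using Omega1_dephasing_depolarizing(2,3)[OF p q(1,2) s] P'
    by (auto simp only: trace_hermitian_mult_Omega[OF hP])
  ultimately have "2 * r * ?W = ?K * (4 * r)"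
    using eq by (simp only: of_real_eq_iff)
  then have "2 * r * (?W - 2 * ?K) = 0" by (simp add: algebra_simps)
  then show False
    using r mismatch unfolding mismatch_radial_deriv by simp
qed

theorem theorem21:
  fixes p q E :: real
    and N1 N2 :: "complex^2^2 \<Rightarrow> complex^2^2"
    and f :: "complex^2^2 \<Rightarrow> real"
    and H :: "complex^2^2"
    and M N_M :: "(complex^2^2) set"
  assumes "p = 0.05" and "q = 0.4"
    and "N1 = dephasing q" and "N2 = depolarizing p"
    and "f = neg_relative_entropy N1 N2"
    and "H \<in> {pauli_x, pauli_y, pauli_z}"
    and "E \<in> {-1<..<1}"
    and "M = {\<rho>. density_operator \<rho> \<and> trace (\<rho> ** H) = complex_of_real E}"
    and "N_M = span {mat 1, H}"
  shows "(\<forall>\<rho>. density_operator \<rho> \<and> positive_definite \<rho> \<longrightarrow>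
            complex_of_real (f \<rho>) = trace (\<rho> ** Omega N1 N2 \<rho>)) \<and>
         (\<exists>\<rho>\<in>M. positive_definite \<rho> \<and>
            (\<exists>G. is_gradient f \<rho> G) \<and>
            (\<forall>G. is_gradient f \<rho> G \<longrightarrow> Omega N1 N2 \<rho> - G \<notin> N_M))"
proof (intro conjI allI impI)
  fix \<rho> :: "complex^2^2"
  assume "density_operator \<rho> \<and> positive_definite \<rho>"
  then show "complex_of_real (f \<rho>) = trace (\<rho> ** Omega N1 N2 \<rho>)"
    unfolding \<open>f = _\<close> by (intro neg_relative_entropy_eq_trace_Omega(1)) simp
next
  have p: "p = 1/20" "0 < p" "p < 1" and q: "q = 2/5" "0 < q" "q < 1" "q \<noteq> 1/2"
    using assms(1,2) by simp_all
  have E: "E\<^sup>2 < 1" using assms(7) by (simp add: abs_square_less_1 abs_less_iff)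
  show "\<exists>\<rho>\<in>M. positive_definite \<rho> \<and> (\<exists>G. is_gradient f \<rho> G) \<and>
      (\<forall>G. is_gradient f \<rho> G \<longrightarrow> Omega N1 N2 \<rho> - G \<notin> N_M)" (is ?goal)
  proof -
    have witness: ?goal
      if "0 < x\<^sup>2 + y\<^sup>2 + z\<^sup>2" "x\<^sup>2 + y\<^sup>2 + z\<^sup>2 < 1"
        and "mismatch p q (x\<^sup>2 + y\<^sup>2 + z\<^sup>2) (z\<^sup>2) \<noteq> 0"
        and "P = pauli_x \<and> x \<noteq> 0 \<or> P = pauli_y \<and> y \<noteq> 0" "trace (P ** H) = 0"
        and "trace (bloch x y z ** H) = complex_of_real E" for x y z P
    proof (intro bexI[of _ "bloch x y z"] conjI allI impI)
      show "positive_definite (bloch x y z)" "bloch x y z \<in> M"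
        using that by (simp_all add: positive_definite_bloch density_operator_bloch assms(8))
      show "\<exists>G. is_gradient f (bloch x y z) G"
        using is_gradient_exists[OF p(2,3) q(2-4) that(1,2)] by (simp add: assms(3-5))
      show "Omega N1 N2 (bloch x y z) - G \<notin> N_M" if "is_gradient f (bloch x y z) G" for G
        using Omega_minus_gradient_notin_span[OF p(2,3) q(2-4) \<open>0 < x\<^sup>2 + y\<^sup>2 + z\<^sup>2\<close>] that
          \<open>x\<^sup>2 + y\<^sup>2 + z\<^sup>2 < 1\<close> \<open>mismatch p q _ _ \<noteq> 0\<close> \<open>P = _ \<and> _ \<or> _\<close> \<open>trace (P ** H) = 0\<close>
        by (simp add: assms(3-5,9))
    qed
    \<comment> \<open>For \<sigma>_x and \<sigma>_y the Bloch vector has components E and r in the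
      x-y plane; this r is nonzero and makes s = (1 + E^2)/2 < 1.\<close>
    define r where "r = sqrt ((1 - E\<^sup>2) / 2)"
    have r: "r \<noteq> 0" "r\<^sup>2 = (1 - E\<^sup>2) / 2" using E by (simp_all add: r_def)
    have s: "0 < r\<^sup>2 + E\<^sup>2"
      using r(1) by (simp add: add_pos_nonneg)
    have s1: "r\<^sup>2 + E\<^sup>2 < 1"
      using E by (simp add: r(2) field_simps)
    have "0 < mismatch p q (r\<^sup>2 + E\<^sup>2) 0"
      using mismatch_0_pos[OF p(2,3) q(2), of "r\<^sup>2 + E\<^sup>2"] s s1 by simp
    then have mis: "mismatch p q (E\<^sup>2 + r\<^sup>2 + 0\<^sup>2) (0\<^sup>2) \<noteq> 0" "mismatch p q (r\<^sup>2 + E\<^sup>2 + 0\<^sup>2) (0\<^sup>2) \<noteq> 0"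
      by (simp_all add: add.commute)
    have off: "trace (pauli_y ** pauli_x) = 0" "trace (pauli_x ** pauli_y) = 0" "trace (pauli_x ** pauli_z) = 0"
      by (simp_all add: matrix_2_simps)
    from assms(6) consider "H = pauli_x" | "H = pauli_y" | "H = pauli_z" by blast
    then show ?goal
    proof cases
      case 1
      \<comment> \<open>P is the transverse Pauli matrix other than H, along which the Bloch vector
        has the nonzero component r.\<close>
      show ?thesis
        by (rule witness[of E r 0 pauli_y])
          (use s s1 r(1) mis in \<open>simp_all add: 1 off trace_bloch_pauli add.commute\<close>)
    next
      case 2
      show ?thesis
        by (rule witness[of r E 0 pauli_x])
          (use s s1 r(1) mis in \<open>simp_all add: 2 off trace_bloch_pauli\<close>)
    next
      case 3
      \<comment> \<open>Here z = E is forced, so s is chosen first and the remaining length sqrt(s -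
        E^2) goes to x.\<close>
      obtain s where s: "E\<^sup>2 < s" "0 < s" "s < 1" "mismatch p q s (E\<^sup>2) \<noteq> 0"
        unfolding p(1) q(1) by (rule exists_mismatch[OF zero_le_power2 E])
      have r: "sqrt (s - E\<^sup>2) \<noteq> 0" "(sqrt (s - E\<^sup>2))\<^sup>2 + 0\<^sup>2 + E\<^sup>2 = s" using s(1) by simp_all
      show ?thesis
        by (rule witness[of "sqrt (s - E\<^sup>2)" 0 E pauli_x, unfolded r(2), OF s(2-4)])
          (use r(1) in \<open>simp_all add: 3 off trace_bloch_pauli\<close>)
    qed
  qed
qed

end
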